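(* Let $\alpha$ be a countable ordinal and $M$ a simple countable linear order with $r(M)=\alpha$. Suppose that for all countable scattered linear orders $M',N'$ of Hausdorff rank $\beta<\alpha$, $M'\leq_{2\beta+2}N'$ implies $M'\cong N'$. Then for every countable linear order $N$, $M\leq_{2\alpha+1}N$ implies $M\cong N$.
   Context: Back-and-forth relations: $(\mathcal A,\bar a)\leq_\beta(\mathcal B,\bar b)$ means every infinitary $\Pi_\beta$ formula of $L_{\omega_1\omega}$ true of $\bar a$ in $\mathcal A$ is true of $\bar b$ in $\mathcal B$ (here $\Sigma_0=\Pi_0$ are finitary quantifier-free formulas; $\Sigma_\beta$ formulas are countable disjunctions of $\exists\bar x\,\varphi$ with $\varphi$ $\Pi_\gamma$, $\gamma<\beta$; $\Pi_\beta$ formulas are countable conjunctions of $\forall\bar x\,\varphi$ with $\varphi$ $\Sigma_\gamma$, $\gamma<\beta$). Hausdorff rank: $HR_0$ = finite linear orders (including empty); for $\alpha>0$, $HR_\alpha$ is the least class containing all $\sum_{i\in\zeta}L_i$ with $L_i\in\bigcup_{\beta<\alpha}HR_\beta$ and closed under finite sums; $r(L)$ = least $\alpha$ with $L\in HR_\alpha$. A countable linear order is scattered iff it has some countable Hausdorff rank. Simple: a linear order $L$ of Hausdorff rank $\alpha$ is simple if $L=\sum_{i\in\omega}L_i+\sum_{j\in\omega^*}L_j$ with $\lim_{i\to\omega}(r(L_i)+1)=\alpha$ or $\lim_{j\to\omega^*}(r(L_j)+1)=\alpha$.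
   Formalization: In the definition of simple, all summands L_i and L_j on both sides are additionally required to have Hausdorff rank below α; without this ω+ω would be simple of rank 1, and ω+ω ≤_3 ω would refute the claim. *)

theory Defs
  imports Complex_Main "HOL-Library.Countable_Set_Type"
begin

unbundle cardinal_syntax

section \<open>Countable ordinals\<close>

text \<open>
  The library has no type of ordinals.  Every ordinal occurring below is countable, so ordinals
  are represented by the elements of the least uncountable well-order \<open>cardSuc natLeq\<close>, an
  element standing for the order type of the set of its predecessors.
\<close>

typedef cord = "Field (cardSuc natLeq)" morphisms of_cord to_cord
proof -
  have "infinite (Field (cardSuc natLeq))"
    using cardSuc_finite[OF natLeq_Card_order] by (simp add: Field_natLeq)
  then show ?thesis
    by (metis finite.emptyI all_not_in_conv)
qed

lemma Well_order_omega1: "Well_order (cardSuc natLeq)"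
  using cardSuc_Card_order[OF natLeq_Card_order] by (simp add: card_order_on_def)

instantiation cord :: linorder
begin

definition less_eq_cord :: "cord \<Rightarrow> cord \<Rightarrow> bool" where
  "a \<le> b \<longleftrightarrow> (of_cord a, of_cord b) \<in> cardSuc natLeq"

definition less_cord :: "cord \<Rightarrow> cord \<Rightarrow> bool" where
  "(a :: cord) < b \<longleftrightarrow> a \<le> b \<and> a \<noteq> b"

instance
proof
  fix x y z :: cord
  have lin: "Linear_order (cardSuc natLeq)"
    using Well_order_omega1 by (simp add: well_order_on_def)
  have r: "refl_on (Field (cardSuc natLeq)) (cardSuc natLeq)" and t: "trans (cardSuc natLeq)"
    and a: "antisym (cardSuc natLeq)" and tot: "total_on (Field (cardSuc natLeq)) (cardSuc natLeq)"
    using lin by (auto simp: order_on_defs)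
  show "x \<le> x"
    using r of_cord[of x] by (auto simp: less_eq_cord_def refl_on_def)
  show "x \<le> z" if "x \<le> y" "y \<le> z"
    using that t unfolding less_eq_cord_def by (meson transD)
  show eq: "x = y" if "x \<le> y" "y \<le> x"
    using that a unfolding less_eq_cord_def by (meson antisymD of_cord_inject)
  show "x < y \<longleftrightarrow> x \<le> y \<and> \<not> y \<le> x"
    using a \<open>x \<le> x\<close> unfolding less_cord_def less_eq_cord_def by (metis antisymD of_cord_inject)
  show "x \<le> y \<or> y \<le> x"
    using tot of_cord[of x] of_cord[of y] \<open>x \<le> x\<close> unfolding less_eq_cord_def total_on_def
    by (metis of_cord_inject)
qed

end

instantiation cord :: linorder_topology
begin

definition open_cord :: "cord set \<Rightarrow> bool" where
  "(open :: cord set \<Rightarrow> bool) = generate_topology (range (\<lambda>a. {..<a}) \<union> range (\<lambda>a. {a<..}))"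

instance
  by standard (rule open_cord_def)

end

lemma wf_cord: "wf {(x, y :: cord). x < y}"
proof -
  have "wf (cardSuc natLeq - Id)"
    using Well_order_omega1 by (simp add: well_order_on_def)
  then have "wf (inv_image (cardSuc natLeq - Id) of_cord)"
    by (rule wf_inv_image)
  moreover have "{(x, y :: cord). x < y} \<subseteq> inv_image (cardSuc natLeq - Id) of_cord"
    by (auto simp: less_cord_def less_eq_cord_def inv_image_def of_cord_inject)
  ultimately show ?thesis
    by (rule wf_subset)
qed

instance cord :: wellorder
proof
  fix P :: "cord \<Rightarrow> bool" and a
  assume "\<And>x. (\<And>y. y < x \<Longrightarrow> P y) \<Longrightarrow> P x"
  then show "P a"
    using wf_induct[OF wf_cord, of P a] by auto
qed

lemma countable_predecessors: "countable {..a :: cord}"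
proof -
  let ?r = "cardSuc natLeq"
  have "Card_order ?r"
    by (rule cardSuc_Card_order[OF natLeq_Card_order])
  moreover have "infinite (Field ?r)"
    using cardSuc_finite[OF natLeq_Card_order] by (simp add: Field_natLeq)
  moreover have "|under ?r (of_cord a)| <o ?r"
  proof -
    have "\<exists>b\<in>Field ?r. of_cord a \<noteq> b \<and> (of_cord a, b) \<in> ?r"
      using infinite_Card_order_limit[OF calculation] of_cord[of a] by blast
    then obtain b where b: "b \<in> Field ?r" "of_cord a \<noteq> b" "(of_cord a, b) \<in> ?r"
      by blast
    have lin: "trans ?r" "antisym ?r"
      using Well_order_omega1 by (auto simp: order_on_defs)
    have "under ?r (of_cord a) \<subseteq> underS ?r b"
      using b lin unfolding under_def underS_def
      by (auto dest: transD antisymD)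
    then have "|under ?r (of_cord a)| \<le>o |underS ?r b|"
      by (rule card_of_mono1)
    moreover have "|underS ?r b| <o ?r"
      using card_of_underS[OF \<open>Card_order ?r\<close> b(1)] .
    ultimately show ?thesis
      using ordLeq_ordLess_trans by blast
  qed
  then have "|under ?r (of_cord a)| \<le>o natLeq"
    using cardSuc_ordLeq_ordLess[OF natLeq_Card_order, of "|under ?r (of_cord a)|"] card_of_Card_order
    by blast
  then have "countable (under ?r (of_cord a))"
    using countable_card_le_natLeq by blast
  moreover have "of_cord ` {..a} \<subseteq> under ?r (of_cord a)"
    by (auto simp: less_eq_cord_def under_def)
  ultimately have "countable (of_cord ` {..a})"
    by (meson countable_subset)
  then show ?thesis
    by (rule countable_image_inj_on) (auto simp: inj_on_def of_cord_inject)
qed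

lemma uncountable_cord: "uncountable (UNIV :: cord set)"
proof
  let ?r = "cardSuc natLeq"
  assume "countable (UNIV :: cord set)"
  then have "countable (of_cord ` UNIV)"
    by (rule countable_image)
  moreover have "of_cord ` UNIV = Field ?r"
    using type_definition.Rep_range[OF type_definition_cord] by simp
  ultimately have "|Field ?r| \<le>o natLeq"
    using countable_card_le_natLeq by metis
  moreover have "|Field ?r| =o ?r"
    by (rule card_of_Field_ordIso[OF cardSuc_Card_order[OF natLeq_Card_order]])
  moreover have "natLeq <o ?r"
    by (rule cardSuc_greater[OF natLeq_Card_order])
  ultimately show False
    by (meson not_ordLess_ordIso ordIso_iff_ordLeq ordLess_ordLeq_trans not_ordLess_ordLeq)
qed

lemma countable_bounded_cord:
  fixes S :: "cord set"
  assumes "countable S"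
  shows "\<exists>b. \<forall>a\<in>S. a < b"
proof (rule ccontr)
  assume "\<not> ?thesis"
  then have "UNIV \<subseteq> (\<Union>a\<in>S. {..a})"
    by (force simp: not_less)
  moreover have "countable (\<Union>a\<in>S. {..a})"
    using assms countable_predecessors by blast
  ultimately show False
    using uncountable_cord countable_subset by blast
qed

unbundle no cardinal_syntax

instantiation cord :: zero
begin
definition zero_cord :: cord where "0 = (LEAST a :: cord. True)"
instance ..
end

lemma zero_le_cord [simp]: "(0 :: cord) \<le> a"
  by (simp add: zero_cord_def Least_le)

definition osucc :: "cord \<Rightarrow> cord" where
  "osucc a = (LEAST b. a < b)"

lemma less_osucc: "a < osucc a"
  using countable_bounded_cord[of "{a}"] unfolding osucc_def by (metis LeastI_ex countable_finite
    finite.emptyI finite.insertI insertI1)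

lemma osucc_le_iff: "osucc a \<le> b \<longleftrightarrow> a < b"
  using less_osucc[of a] by (auto simp: osucc_def intro: Least_le order.strict_trans2)

text \<open>
  \<open>odouble a\<close> is the ordinal product \<open>2 \<cdot> a\<close> (the sum of \<open>a\<close> copies of \<open>2\<close>, so that
  \<open>2 \<cdot> \<omega> = \<omega>\<close>): it is the supremum of \<open>2 \<cdot> b + 2\<close> over \<open>b < a\<close>.
\<close>

function odouble :: "cord \<Rightarrow> cord" where
  "odouble a = (LEAST c. \<forall>d \<in> (\<lambda>b. osucc (odouble b)) ` {..<a}. d < c)"
  by auto
termination
  by (relation "{(x, y). x < y}") (auto simp: wf_cord)

declare odouble.simps [simp del]

lemma odouble_le_iff: "odouble a \<le> c \<longleftrightarrow> (\<forall>b<a. osucc (osucc (odouble b)) \<le> c)"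
proof
  have "countable {..<a}"
    by (rule countable_subset[OF _ countable_predecessors[of a]]) auto
  then have "\<exists>c. \<forall>d \<in> (\<lambda>b. osucc (odouble b)) ` {..<a}. d < c"
    by (intro countable_bounded_cord) simp
  then have "\<forall>d \<in> (\<lambda>b. osucc (odouble b)) ` {..<a}. d < odouble a"
    unfolding odouble.simps[of a] by (rule LeastI_ex)
  then show "\<forall>b<a. osucc (osucc (odouble b)) \<le> c" if "odouble a \<le> c"
    using that by (auto simp: osucc_le_iff intro: order.strict_trans2)
  show "odouble a \<le> c" if "\<forall>b<a. osucc (osucc (odouble b)) \<le> c"
    unfolding odouble.simps[of a] by (rule Least_le) (use that in \<open>auto simp: osucc_le_iff\<close>)
qed

lemma odouble_0: "odouble 0 = 0"
proof (rule antisym)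
  show "odouble 0 \<le> 0"
    unfolding odouble_le_iff using zero_le_cord not_less by blast
qed simp

lemma odouble_osucc: "odouble (osucc a) = osucc (osucc (odouble a))"
proof (rule antisym)
  have mono: "odouble b \<le> odouble a" if "b \<le> a" for b
    using that by (meson odouble_le_iff order.refl order.strict_trans2)
  show "odouble (osucc a) \<le> osucc (osucc (odouble a))"
  proof (subst odouble_le_iff, intro allI impI)
    fix b assume "b < osucc a"
    then have "b \<le> a"
      using osucc_le_iff[of a b] by auto
    then have "odouble b \<le> odouble a"
      by (rule mono)
    then show "osucc (osucc (odouble b)) \<le> osucc (osucc (odouble a))"
      by (metis less_osucc order.strict_trans1 osucc_le_iff)
  qed
  show "osucc (osucc (odouble a)) \<le> odouble (osucc a)"
    using odouble_le_iff[of "osucc a" "odouble (osucc a)"] less_osucc[of a] by auto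
qed

section \<open>Linear orders\<close>

text \<open>
  A linear order is a reflexive relation \<open>L\<close> with \<open>Linear_order L\<close>; its universe is \<open>Field L\<close>,
  which may be empty.  Isomorphism is the library's \<open>iso\<close>, which by \<open>iso_iff2\<close> is the usual
  notion for arbitrary relations.
\<close>

definition isomorphic :: "'a rel \<Rightarrow> 'b rel \<Rightarrow> bool" (infix \<open>\<cong>\<^sub>o\<close> 50) where
  "L \<cong>\<^sub>o L' \<longleftrightarrow> (\<exists>f. iso L L' f)"

definition scattered :: "'a rel \<Rightarrow> bool" where
  "scattered L \<longleftrightarrow>
    \<not> (\<exists>f :: rat \<Rightarrow> 'a. range f \<subseteq> Field L \<and> (\<forall>p q. p \<le> q \<longleftrightarrow> (f p, f q) \<in> L))"

text \<open>The sum of the orders \<open>L i\<close> along the index order \<open>I\<close>.\<close>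

definition order_sum :: "'i rel \<Rightarrow> ('i \<Rightarrow> 'a rel) \<Rightarrow> ('i \<times> 'a) rel" where
  "order_sum I L =
    {((i, a), (j, b)). i \<in> Field I \<and> j \<in> Field I \<and> a \<in> Field (L i) \<and> b \<in> Field (L j) \<and>
       (i \<noteq> j \<and> (i, j) \<in> I \<or> i = j \<and> (a, b) \<in> L i)}"

definition order_plus :: "'a rel \<Rightarrow> 'b rel \<Rightarrow> ('a + 'b) rel" where
  "order_plus L L' =
    map_prod Inl Inl ` L \<union> map_prod Inr Inr ` L' \<union> (Inl ` Field L) \<times> (Inr ` Field L')"

definition omega :: "nat rel" where "omega = {(i, j). i \<le> j}"
definition omega_star :: "nat rel" where "omega_star = {(i, j). j \<le> i}"
definition zeta :: "int rel" where "zeta = {(i, j). i \<le> j}"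
definition fin_ord :: "nat \<Rightarrow> nat rel" where "fin_ord n = {(i, j). i \<le> j \<and> j < n}"

section \<open>Hausdorff rank\<close>

text \<open>
  \<open>HR \<alpha> L\<close> says that \<open>L\<close> is in the class \<open>HR\<^sub>\<alpha>\<close>; the classes are closed under isomorphism.
  The clauses for \<open>\<alpha>\<close> only refer to \<open>HR\<^sub>\<alpha>\<close> itself and to earlier classes, so the simultaneous least
  fixed point is the transfinite recursion.  Taking the summands over the same type as the
  sum is no restriction, since each summand is isomorphic to a suborder of the sum.
\<close>

inductive HR :: "cord \<Rightarrow> 'a rel \<Rightarrow> bool" where
  finite_order: "Linear_order L \<Longrightarrow> finite (Field L) \<Longrightarrow> HR 0 L"
| zeta_sum: "0 < \<alpha> \<Longrightarrow> (\<And>i. \<exists>\<beta><\<alpha>. HR \<beta> (L i)) \<Longrightarrow> K \<cong>\<^sub>o order_sum zeta L \<Longrightarrow>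
    Linear_order K \<Longrightarrow> HR \<alpha> K"
| finite_sum: "0 < \<alpha> \<Longrightarrow> (\<And>i. i < n \<Longrightarrow> HR \<alpha> (L i)) \<Longrightarrow> K \<cong>\<^sub>o order_sum (fin_ord n) L \<Longrightarrow>
    Linear_order K \<Longrightarrow> HR \<alpha> K"

text \<open>\<open>r(L) = \<alpha>\<close>; stated as a relation because a non-scattered order has no rank.\<close>

definition has_rank :: "'a rel \<Rightarrow> cord \<Rightarrow> bool" where
  "has_rank L \<alpha> \<longleftrightarrow> HR \<alpha> L \<and> (\<forall>\<beta><\<alpha>. \<not> HR \<beta> L)"

text \<open>
  The summands of a simple order of rank \<open>\<alpha>\<close> are required to have rank below \<open>\<alpha>\<close>, as the
  summands in the definition of \<open>HR\<^sub>\<alpha>\<close> are; the limit condition, which concerns one of the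
  two sides and only its tail, does not imply this.  Without the requirement
  \<open>\<omega> + \<omega>\<close> would be simple, with the second \<open>\<omega>\<close> a single summand of rank \<open>1\<close>.
  The summands on the right are ordered \<open>\<dots> + B 2 + B 1 + B 0\<close>, so that \<open>j \<rightarrow> \<omega>\<^sup>*\<close> means
  that the index \<open>j\<close> of \<open>B j\<close> tends to infinity.  Limits are taken in the order topology.
\<close>

definition simple_order :: "'a rel \<Rightarrow> bool" where
  "simple_order L \<longleftrightarrow> (\<exists>\<alpha> A B \<rho> \<sigma>. has_rank L \<alpha> \<and>
     (\<forall>i :: nat. has_rank (A i :: 'a rel) (\<rho> i) \<and> \<rho> i < \<alpha>) \<and>
     (\<forall>j :: nat. has_rank (B j :: 'a rel) (\<sigma> j) \<and> \<sigma> j < \<alpha>) \<and>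
     L \<cong>\<^sub>o order_plus (order_sum omega A) (order_sum omega_star B) \<and>
     ((\<lambda>i. osucc (\<rho> i)) \<longlonglongrightarrow> \<alpha> \<or> (\<lambda>j. osucc (\<sigma> j)) \<longlonglongrightarrow> \<alpha>))"

section \<open>Infinitary formulas and back-and-forth relations\<close>

text \<open>Formulas of \<open>L\<^bsub>\<omega>\<^sub>1\<omega>\<^esub>\<close> in the language of linear orders, with variables indexed by \<open>nat\<close>.\<close>

datatype fm =
    Leq nat nat
  | Eq nat nat
  | Neg fm
  | Conj "fm cset"
  | Disj "fm cset"
  | Ex nat fm
  | All nat fm

primrec free_vars :: "fm \<Rightarrow> nat set" where
  "free_vars (Leq x y) = {x, y}"
| "free_vars (Eq x y) = {x, y}"
| "free_vars (Neg \<phi>) = free_vars \<phi>"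
| "free_vars (Conj \<Phi>) = \<Union> (rcset (cimage free_vars \<Phi>))"
| "free_vars (Disj \<Phi>) = \<Union> (rcset (cimage free_vars \<Phi>))"
| "free_vars (Ex x \<phi>) = free_vars \<phi> - {x}"
| "free_vars (All x \<phi>) = free_vars \<phi> - {x}"

primrec sat :: "'a rel \<Rightarrow> fm \<Rightarrow> (nat \<Rightarrow> 'a) \<Rightarrow> bool" where
  "sat A (Leq x y) = (\<lambda>s. (s x, s y) \<in> A)"
| "sat A (Eq x y) = (\<lambda>s. s x = s y)"
| "sat A (Neg \<phi>) = (\<lambda>s. \<not> sat A \<phi> s)"
| "sat A (Conj \<Phi>) = (\<lambda>s. \<forall>P \<in> rcset (cimage (sat A) \<Phi>). P s)"
| "sat A (Disj \<Phi>) = (\<lambda>s. \<exists>P \<in> rcset (cimage (sat A) \<Phi>). P s)"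
| "sat A (Ex x \<phi>) = (\<lambda>s. \<exists>a \<in> Field A. sat A \<phi> (s(x := a)))"
| "sat A (All x \<phi>) = (\<lambda>s. \<forall>a \<in> Field A. sat A \<phi> (s(x := a)))"

inductive finitary_qf :: "fm \<Rightarrow> bool" where
  "finitary_qf (Leq x y)"
| "finitary_qf (Eq x y)"
| "finitary_qf \<phi> \<Longrightarrow> finitary_qf (Neg \<phi>)"
| "finite (rcset \<Phi>) \<Longrightarrow> (\<And>\<phi>. \<phi> \<in> rcset \<Phi> \<Longrightarrow> finitary_qf \<phi>) \<Longrightarrow> finitary_qf (Conj \<Phi>)"
| "finite (rcset \<Phi>) \<Longrightarrow> (\<And>\<phi>. \<phi> \<in> rcset \<Phi> \<Longrightarrow> finitary_qf \<phi>) \<Longrightarrow> finitary_qf (Disj \<Phi>)"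

inductive Sigma_fm :: "cord \<Rightarrow> fm \<Rightarrow> bool" and Pi_fm :: "cord \<Rightarrow> fm \<Rightarrow> bool" where
  "finitary_qf \<phi> \<Longrightarrow> Sigma_fm 0 \<phi>"
| "finitary_qf \<phi> \<Longrightarrow> Pi_fm 0 \<phi>"
| "0 < \<beta> \<Longrightarrow>
    (\<And>\<psi>. \<psi> \<in> rcset \<Phi> \<Longrightarrow> \<exists>xs \<phi> \<gamma>. \<psi> = foldr Ex xs \<phi> \<and> \<gamma> < \<beta> \<and> Pi_fm \<gamma> \<phi>) \<Longrightarrow>
    Sigma_fm \<beta> (Disj \<Phi>)"
| "0 < \<beta> \<Longrightarrow>
    (\<And>\<psi>. \<psi> \<in> rcset \<Phi> \<Longrightarrow> \<exists>xs \<phi> \<gamma>. \<psi> = foldr All xs \<phi> \<and> \<gamma> < \<beta> \<and> Sigma_fm \<gamma> \<phi>) \<Longrightarrow>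
    Pi_fm \<beta> (Conj \<Phi>)"

text \<open>
  \<open>(A, as) \<le>\<^sub>\<beta> (B, bs)\<close> for tuples \<open>as\<close>, \<open>bs\<close> of equal length, where the tuple interprets the
  variables \<open>0, \<dots>, length as - 1\<close>; the values of the assignments elsewhere are irrelevant
  because of the restriction on the free variables.
\<close>

definition bf_le_tuples :: "cord \<Rightarrow> 'a rel \<times> 'a list \<Rightarrow> 'b rel \<times> 'b list \<Rightarrow> bool" where
  "bf_le_tuples \<beta> = (\<lambda>(A, as) (B, bs). length as = length bs \<and>
     (\<forall>\<phi>. Pi_fm \<beta> \<phi> \<and> free_vars \<phi> \<subseteq> {..<length as} \<longrightarrow>
        sat A \<phi> (\<lambda>i. as ! i) \<longrightarrow> sat B \<phi> (\<lambda>i. bs ! i)))"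

definition bf_le :: "'a rel \<Rightarrow> cord \<Rightarrow> 'b rel \<Rightarrow> bool" (\<open>_ \<le>\<^bsub>_\<^esub> _\<close> [51, 0, 51] 50) where
  "A \<le>\<^bsub>\<beta>\<^esub> B \<longleftrightarrow> bf_le_tuples \<beta> (A, []) (B, [])"

end

theory Submission
  imports Defs
begin

text \<open>
  Countable linear orders are represented by sets of reals.  Call \<open>X\<close> short at \<open>\<alpha>\<close> if every point of \<open>X\<close>
  has an initial or a final segment of rank below \<open>\<alpha>\<close>; simple orders of rank \<open>\<alpha>\<close> are short at \<open>\<alpha>\<close>.
  By induction on \<open>\<alpha>\<close>, if \<open>X\<close> is short at \<open>\<alpha>\<close> and \<open>X \<le> Y\<close> at level \<open>2\<alpha> + 1\<close>, then \<open>X \<cong> Y\<close>.  Since an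
  order of rank at most \<open>\<epsilon>\<close> is split by finitely many points into pieces that are short at \<open>\<epsilon>\<close>, the
  induction hypothesis recovers intervals of rank \<open>\<epsilon> < \<alpha>\<close> from level \<open>2\<epsilon> + 2 \<le> 2\<alpha>\<close>.  Hence \<open>Y\<close> is
  short as well, and the parts of \<open>X\<close> and \<open>Y\<close> consisting of the points with a final segment of small
  rank have the same final segments up to isomorphism.  If such a part has no rank below \<open>\<alpha>\<close>, its
  final segments determine it.  Otherwise the least rank \<open>\<delta>\<close> of an interval at its left end is
  considered: cutting both parts at matching points inside that interval leaves two orders that have
  the same final segments and no rank below \<open>\<delta>\<close>, so they are again determined.
\<close>

section \<open>Order isomorphisms between subsets of linear orders, and how to paste them\<close>

definition similar :: "'a::linorder set \<Rightarrow> 'b::linorder set \<Rightarrow> bool" where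
  "similar X Y \<longleftrightarrow> (\<exists>h. strict_mono_on X h \<and> h ` X = Y)"

lemma similarI: "strict_mono_on X h \<Longrightarrow> h ` X = Y \<Longrightarrow> similar X Y"
  by (auto simp: similar_def)

lemma similar_refl [simp]: "similar X X"
  by (rule similarI[of _ id]) (auto simp: strict_mono_on_def)

lemma strict_mono_on_less_iff:
  fixes h :: "'a::linorder \<Rightarrow> 'b::linorder"
  assumes "strict_mono_on X h" "x \<in> X" "y \<in> X"
  shows "h x < h y \<longleftrightarrow> x < y"
proof
  show "x < y" if "h x < h y"
  proof (rule ccontr)
    assume "\<not> x < y"
    then have "x = y \<or> h y < h x"
      using assms by (auto simp: not_less order_le_less dest: strict_mono_onD)
    then show False
      using that by auto
  qed
qed (rule strict_mono_onD[OF assms])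

lemma similar_sym:
  assumes "similar X Y"
  shows "similar Y X"
proof -
  obtain h where h: "strict_mono_on X h" "h ` X = Y"
    using assms by (auto simp: similar_def)
  have inj: "inj_on h X"
    using h(1) by (rule strict_mono_on_imp_inj_on)
  show ?thesis
  proof (rule similarI[of _ "inv_into X h"])
    show "strict_mono_on Y (inv_into X h)"
    proof (rule strict_mono_onI)
      fix r s assume rs: "r \<in> Y" "s \<in> Y" "r < s"
      then show "inv_into X h r < inv_into X h s"
        using strict_mono_on_less_iff[OF h(1), of "inv_into X h r" "inv_into X h s"] h(2)
        by (simp add: f_inv_into_f inv_into_into)
    qed
    show "inv_into X h ` Y = X"
      using inj h(2) by (metis inv_into_image_cancel order_refl)
  qed
qed

lemma strict_mono_on_piecewise:
  fixes h :: "'a::linorder \<Rightarrow> 'b::linorder"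
  assumes "strict_mono_on A h" "strict_mono_on B h"
    and "\<And>a b. a \<in> A \<Longrightarrow> b \<in> B \<Longrightarrow> a < b \<and> h a < h b"
  shows "strict_mono_on (A \<union> B) h"
proof (rule strict_mono_onI)
  fix x y assume xy: "x \<in> A \<union> B" "y \<in> A \<union> B" "x < y"
  then consider "x \<in> A" "y \<in> A" | "x \<in> A" "y \<in> B" | "x \<in> B" "y \<in> B" | "x \<in> B" "y \<in> A"
    by blast
  then show "h x < h y"
  proof cases
    case 4
    then have "y < x"
      using assms(3) by blast
    then show ?thesis
      using xy(3) by simp
  qed (use assms xy(3) in \<open>auto dest: strict_mono_onD\<close>)
qed

lemma similar_Un:
  assumes "similar A A'" "similar B B'"
    and AB: "\<And>a b. a \<in> A \<Longrightarrow> b \<in> B \<Longrightarrow> a < b"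
    and AB': "\<And>a b. a \<in> A' \<Longrightarrow> b \<in> B' \<Longrightarrow> a < b"
  shows "similar (A \<union> B) (A' \<union> B')"
proof -
  obtain f g where f: "strict_mono_on A f" "f ` A = A'" and g: "strict_mono_on B g" "g ` B = B'"
    using assms(1,2) by (auto simp: similar_def)
  define h where "h x = (if x \<in> A then f x else g x)" for x
  have hA: "h x = f x" if "x \<in> A" for x using that by (simp add: h_def)
  have hB: "h x = g x" if "x \<in> B" for x using that AB by (auto simp: h_def)
  show ?thesis
  proof (rule similarI)
    show "strict_mono_on (A \<union> B) h"
    proof (rule strict_mono_on_piecewise)
      show "strict_mono_on A h" using f(1) hA by (simp add: strict_mono_on_def)
      show "strict_mono_on B h" using g(1) hB by (simp add: strict_mono_on_def)
      show "a < b \<and> h a < h b" if "a \<in> A" "b \<in> B" for a b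
        using that AB AB' f(2) g(2) hA hB by auto
    qed
    have "h ` A = A'" "h ` B = B'"
      using f(2) g(2) hA hB by (simp_all cong: image_cong)
    then show "h ` (A \<union> B) = A' \<union> B'" by (simp add: image_Un)
  qed
qed

lemma similar_split:
  assumes "a \<in> A" "b \<in> B" "similar (A \<inter> {..<a}) (B \<inter> {..<b})" "similar (A \<inter> {a<..}) (B \<inter> {b<..})"
  shows "similar A B"
proof -
  have "similar {a} {b}"
    by (rule similarI[of _ "\<lambda>_. b"]) (auto simp: strict_mono_on_def)
  then have "similar (A \<inter> {..<a} \<union> {a}) (B \<inter> {..<b} \<union> {b})"
    by (rule similar_Un[OF assms(3)]) auto
  then have "similar (A \<inter> {..<a} \<union> {a} \<union> A \<inter> {a<..}) (B \<inter> {..<b} \<union> {b} \<union> B \<inter> {b<..})"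
    by (rule similar_Un[OF _ assms(4)]) auto
  moreover have "A \<inter> {..<a} \<union> {a} \<union> A \<inter> {a<..} = A" "B \<inter> {..<b} \<union> {b} \<union> B \<inter> {b<..} = B"
    using assms(1,2) by auto
  ultimately show ?thesis by simp
qed

text \<open>Used with \<open>H = F - G\<close>, where it is the piece of \<open>X\<close> lying
  above exactly the points \<open>G\<close> of a set \<open>F\<close> of cut points. One expression
  covers bounded and unbounded pieces, so \<open>F\<close> never has to be listed in increasing
  order.\<close>

definition between :: "'a::linorder set \<Rightarrow> 'a set \<Rightarrow> 'a set \<Rightarrow> 'a set" where
  "between G H X = {x \<in> X. (\<forall>g\<in>G. g < x) \<and> (\<forall>h\<in>H. x < h)}"

lemma between_empty [simp]: "between {} {} X = X"
  and between_below: "between {} {c} X = X \<inter> {..<c}"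
  and between_above: "between {c} {} X = X \<inter> {c<..}"
  by (auto simp: between_def)

text \<open>A point outside \<open>F\<close> lies in the piece given by the members of
  \<open>F\<close> below it and is moved by the isomorphism chosen for that piece. Points of
  different pieces are separated by a point of \<open>F\<close>, and their images by its
  image.\<close>

lemma similar_glue:
  assumes f: "strict_mono_on F f" and FX: "F \<subseteq> X" and fF: "f ` F \<subseteq> Y"
    and pieces: "\<And>G. G \<subseteq> F \<Longrightarrow> similar (between G (F - G) X) (between (f ` G) (f ` (F - G)) Y)"
  shows "similar X Y"
proof -
  define k where "k G = (SOME k. strict_mono_on (between G (F - G) X) k \<and>
      k ` between G (F - G) X = between (f ` G) (f ` (F - G)) Y)" for G
  have k: "strict_mono_on (between G (F - G) X) (k G)"
    "k G ` between G (F - G) X = between (f ` G) (f ` (F - G)) Y" if "G \<subseteq> F" for G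
    using someI_ex[OF pieces[OF that, unfolded similar_def]] unfolding k_def by blast+
  define lo where "lo x = {g \<in> F. g < x}" for x
  define h where "h x = (if x \<in> F then f x else k (lo x) x)" for x
  have mem: "x \<in> between (lo x) (F - lo x) X" if "x \<in> X" "x \<notin> F" for x
    using that by (auto simp: between_def lo_def not_less order_le_less)
  have hmem: "h x \<in> between (f ` lo x) (f ` (F - lo x)) Y" if "x \<in> X" "x \<notin> F" for x
  proof -
    have "k (lo x) x \<in> between (f ` lo x) (f ` (F - lo x)) Y"
      using k(2)[of "lo x"] mem[OF that] by (auto simp: lo_def)
    then show ?thesis using that by (simp add: h_def)
  qed
  have below: "h x < f g" if "x \<in> X" "g \<in> F" "x < g" for x g
  proof (cases "x \<in> F")
    case True then show ?thesis using that f by (simp add: h_def strict_mono_onD)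
  next
    case False then show ?thesis using hmem[OF that(1) False] that by (auto simp: between_def lo_def)
  qed
  have above: "f g < h x" if "x \<in> X" "g \<in> F" "g < x" for x g
  proof (cases "x \<in> F")
    case True then show ?thesis using that f by (simp add: h_def strict_mono_onD)
  next
    case False then show ?thesis using hmem[OF that(1) False] that by (auto simp: between_def lo_def)
  qed
  show ?thesis
  proof (rule similarI)
    show "strict_mono_on X h"
    proof (rule strict_mono_onI)
      fix x y assume xy: "x \<in> X" "y \<in> X" "x < y"
      consider "x \<in> F" | "y \<in> F" | g where "g \<in> F" "x < g" "g < y" | "x \<notin> F" "y \<notin> F" "lo x = lo y"
      proof (cases "x \<in> F \<or> y \<in> F \<or> lo x = lo y")
        case False
        moreover have "lo x \<subseteq> lo y"
          using xy(3) by (auto simp: lo_def)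
        ultimately obtain g where "g \<in> lo y" "g \<notin> lo x"
          by blast
        then have "g \<in> F" "x \<le> g" "g < y"
          by (auto simp: lo_def)
        moreover have "g \<noteq> x"
          using False \<open>g \<in> F\<close> by blast
        ultimately have "g \<in> F" "x < g" "g < y"
          by auto
        then show ?thesis
          using that by blast
      qed (use that in blast)
      then show "h x < h y"
      proof cases
        case 1 then show ?thesis using above[OF xy(2) 1 xy(3)] by (simp add: h_def)
      next
        case 2 then show ?thesis using below[OF xy(1) 2 xy(3)] by (simp add: h_def)
      next
        case 3 then show ?thesis using above[OF xy(2)] below[OF xy(1)] by (meson order.strict_trans)
      next
        case 4
        have "strict_mono_on (between (lo x) (F - lo x) X) (k (lo x))"
          by (rule k(1)) (auto simp: lo_def)
        then show ?thesis
          using mem[OF xy(1) 4(1)] mem[OF xy(2) 4(2)] 4 xy(3) by (auto simp: h_def dest: strict_mono_onD)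
      qed
    qed
    show "h ` X = Y"
    proof
      show "h ` X \<subseteq> Y"
      proof
        fix y assume "y \<in> h ` X"
        then obtain x where "x \<in> X" "y = h x"
          by blast
        then show "y \<in> Y"
          using hmem[of x] fF by (cases "x \<in> F") (auto simp: h_def between_def)
      qed
      show "Y \<subseteq> h ` X"
      proof
        fix y assume y: "y \<in> Y"
        show "y \<in> h ` X"
        proof (cases "y \<in> f ` F")
          case True
          then obtain g where "g \<in> F" "y = h g"
            by (auto simp: h_def)
          then show ?thesis
            using FX by blast
        next
          case False
          \<comment> \<open>The cut points of \<open>Y\<close> below \<open>y\<close> are the images
            of \<open>G\<close>, so this \<open>G\<close> names the piece in which a preimage of
            \<open>y\<close> is found.\<close>
          define G where "G = {g \<in> F. f g < y}"
          have "y < f g" if "g \<in> F - G" for g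
          proof -
            have "f g \<noteq> y" "\<not> f g < y"
              using that False by (auto simp: G_def)
            then show ?thesis
              by (simp add: not_less order_le_less)
          qed
          then have "y \<in> between (f ` G) (f ` (F - G)) Y"
            unfolding between_def using y by (simp add: G_def)
          moreover have "G \<subseteq> F"
            by (auto simp: G_def)
          ultimately obtain x where x: "x \<in> between G (F - G) X" "y = k G x"
            using k(2)[of G] by blast
          have x1: "x \<in> X" "\<And>g. g \<in> G \<Longrightarrow> g < x" "\<And>g. g \<in> F \<Longrightarrow> g \<notin> G \<Longrightarrow> x < g"
            using x(1) by (auto simp: between_def)
          then have "x \<notin> F"
            using less_irrefl[of x] by blast
          moreover have "lo x = G"
            unfolding lo_def using x1(2,3) \<open>G \<subseteq> F\<close> by (blast dest: less_asym)
          ultimately have "y = h x"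
            using x(2) by (simp add: h_def)
          then show ?thesis
            using x1(1) by blast
        qed
      qed
    qed
  qed
qed

section \<open>Rank by counting classes\<close>

text \<open>
  \<open>rank_le \<delta> X\<close> bounds the length of the chains in \<open>X\<close> whose consecutive points are inequivalent
  modulo the \<open>\<delta>\<close>-th Hausdorff condensation, i.e. span an interval of no rank below \<open>\<delta>\<close>.
\<close>

definition chain_bound :: "('a::linorder set \<Rightarrow> bool) \<Rightarrow> nat \<Rightarrow> 'a set \<Rightarrow> bool" where
  "chain_bound Q n X \<longleftrightarrow> (\<forall>xs. set xs \<subseteq> X \<longrightarrow>
     successively (\<lambda>x y. x < y \<and> \<not> Q (X \<inter> {x<..<y})) xs \<longrightarrow> length xs \<le> n)"

function rank_le :: "cord \<Rightarrow> 'a::linorder set \<Rightarrow> bool" where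
  "rank_le \<delta> X = (\<exists>n. chain_bound (\<lambda>Z. \<exists>\<gamma>\<in>{..<\<delta>}. rank_le \<gamma> Z) n X)"
  by auto
termination
  by (relation "inv_image {(x, y). x < y} fst") (auto simp: wf_cord)

declare rank_le.simps [simp del]

definition small :: "cord \<Rightarrow> 'a::linorder set \<Rightarrow> bool" where
  "small \<delta> X \<longleftrightarrow> (\<exists>\<gamma><\<delta>. rank_le \<gamma> X)"

definition gap :: "cord \<Rightarrow> 'a::linorder set \<Rightarrow> 'a \<Rightarrow> 'a \<Rightarrow> bool" where
  "gap \<delta> X x y \<longleftrightarrow> x < y \<and> \<not> small \<delta> (X \<inter> {x<..<y})"

definition classes_le :: "cord \<Rightarrow> nat \<Rightarrow> 'a::linorder set \<Rightarrow> bool" where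
  "classes_le \<delta> n X \<longleftrightarrow> (\<forall>xs. set xs \<subseteq> X \<longrightarrow> successively (gap \<delta> X) xs \<longrightarrow> length xs \<le> n)"

text \<open>Working form of the recursion. At level 0 no set is \<open>small\<close>, so the chains
  are all increasing lists and the condition says that \<open>X\<close> is finite.\<close>

lemma rank_le_iff: "rank_le \<delta> X \<longleftrightarrow> (\<exists>n. classes_le \<delta> n X)"
  unfolding rank_le.simps[of \<delta>] chain_bound_def classes_le_def gap_def[abs_def] small_def
  by (simp add: Bex_def lessThan_iff)

text \<open>The interval between two points embeds into the interval between their images, so gaps
  are sent to gaps and chains to chains. Monotonicity of \<open>small\<close> is a hypothesis here,
  because the argument serves both within the induction that proves this monotonicity and after
  it.\<close>

lemma classes_le_embed_aux:
  fixes f :: "'a::linorder \<Rightarrow> 'a"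
  assumes small: "\<And>(X :: 'a set) Y. small \<delta> X \<Longrightarrow> strict_mono_on Y f \<Longrightarrow> f ` Y \<subseteq> X \<Longrightarrow> small \<delta> Y"
    and X: "classes_le \<delta> n X" and f: "strict_mono_on Y f" "f ` Y \<subseteq> X"
  shows "classes_le \<delta> n Y"
  unfolding classes_le_def
proof (intro allI impI)
  fix xs assume xs: "set xs \<subseteq> Y" "successively (gap \<delta> Y) xs"
  have "successively (\<lambda>x y. gap \<delta> X (f x) (f y)) xs"
  proof (rule successively_mono[OF xs(2)])
    fix x y assume xy: "x \<in> set xs" "y \<in> set xs" "gap \<delta> Y x y"
    then have mem: "x \<in> Y" "y \<in> Y"
      using xs(1) by auto
    then have "f x < f y"
      using f(1) xy(3) by (auto simp: gap_def dest: strict_mono_onD)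
    moreover have "\<not> small \<delta> (X \<inter> {f x<..<f y})"
    proof
      assume "small \<delta> (X \<inter> {f x<..<f y})"
      moreover have "strict_mono_on (Y \<inter> {x<..<y}) f"
        using f(1) by (auto simp: strict_mono_on_def)
      moreover have "f ` (Y \<inter> {x<..<y}) \<subseteq> X \<inter> {f x<..<f y}"
        using f mem by (auto dest: strict_mono_onD[OF f(1)])
      ultimately have "small \<delta> (Y \<inter> {x<..<y})"
        by (rule small)
      then show False
        using xy(3) by (simp add: gap_def)
    qed
    ultimately show "gap \<delta> X (f x) (f y)"
      by (simp add: gap_def)
  qed
  then have "successively (gap \<delta> X) (map f xs)"
    by (simp add: successively_map)
  moreover have "set (map f xs) \<subseteq> X"
    using xs(1) f(2) by auto
  ultimately have "length (map f xs) \<le> n"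
    using X unfolding classes_le_def by blast
  then show "length xs \<le> n"
    by simp
qed

lemma rank_le_embed:
  fixes X Y :: "'a::linorder set"
  assumes "rank_le \<delta> X" "strict_mono_on Y f" "f ` Y \<subseteq> X"
  shows "rank_le \<delta> Y"
  using assms
proof (induction \<delta> arbitrary: X Y rule: less_induct)
  case (less \<delta>)
  have small: "small \<delta> Y" if XY: "small \<delta> X" "strict_mono_on Y f" "f ` Y \<subseteq> X" for X Y :: "'a set"
  proof -
    obtain \<gamma> where "\<gamma> < \<delta>" "rank_le \<gamma> X"
      using XY(1) by (auto simp: small_def)
    then show ?thesis
      using less.IH[of \<gamma> X Y] XY by (auto simp: small_def)
  qed
  obtain n where "classes_le \<delta> n X"
    using less.prems(1) by (auto simp: rank_le_iff)
  from classes_le_embed_aux[OF _ this less.prems(2,3)] small have "classes_le \<delta> n Y"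
    by auto
  then show ?case
    by (auto simp: rank_le_iff)
qed

lemma small_embed:
  fixes X Y :: "'a::linorder set"
  assumes "small \<delta> X" "strict_mono_on Y f" "f ` Y \<subseteq> X"
  shows "small \<delta> Y"
  using assms(1) rank_le_embed[OF _ assms(2,3)] by (auto simp: small_def)

lemma classes_le_embed:
  fixes X Y :: "'a::linorder set"
  assumes "classes_le \<delta> n X" "strict_mono_on Y f" "f ` Y \<subseteq> X"
  shows "classes_le \<delta> n Y"
proof (rule classes_le_embed_aux[OF _ assms])
  show "small \<delta> Y'" if "small \<delta> X'" "strict_mono_on Y' f" "f ` Y' \<subseteq> X'" for X' Y' :: "'a set"
    using that by (rule small_embed)
qed

lemma strict_mono_on_ident: "strict_mono_on Y (\<lambda>x. x)"
  by (simp add: strict_mono_on_def)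

lemma small_subset: "small \<delta> X \<Longrightarrow> Y \<subseteq> X \<Longrightarrow> small \<delta> Y"
  by (rule small_embed[where f = "\<lambda>x. x" and X = X]) (simp_all add: strict_mono_on_ident)

lemma classes_le_subset: "classes_le \<delta> n X \<Longrightarrow> Y \<subseteq> X \<Longrightarrow> classes_le \<delta> n Y"
  by (rule classes_le_embed[where f = "\<lambda>x. x" and X = X]) (simp_all add: strict_mono_on_ident)

lemma rank_le_similar:
  fixes X Y :: "'a::linorder set"
  assumes "similar X Y" "rank_le \<delta> X"
  shows "rank_le \<delta> Y"
proof -
  obtain h where "strict_mono_on Y h" "h ` Y = X"
    using similar_sym[OF assms(1)] unfolding similar_def by blast
  then show ?thesis
    using rank_le_embed[OF assms(2), of Y h] by simp
qed

lemma small_similar: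
  fixes X Y :: "'a::linorder set"
  assumes "similar X Y" "small \<delta> X"
  shows "small \<delta> Y"
proof -
  obtain h where "strict_mono_on Y h" "h ` Y = X"
    using similar_sym[OF assms(1)] unfolding similar_def by blast
  then show ?thesis
    using small_embed[OF assms(2), of Y h] by simp
qed

lemma classes_le_similar:
  fixes X Y :: "'a::linorder set"
  assumes "similar X Y" "classes_le \<delta> n X"
  shows "classes_le \<delta> n Y"
proof -
  obtain h where "strict_mono_on Y h" "h ` Y = X"
    using similar_sym[OF assms(1)] unfolding similar_def by blast
  then show ?thesis
    using classes_le_embed[OF assms(2), of Y h] by simp
qed

text \<open>Two consecutive points of a chain would span an interval that is not small, yet every
  subset of a small set is small.\<close>

lemma classes_le_Suc_0_of_small: "small \<delta> X \<Longrightarrow> classes_le \<delta> (Suc 0) X"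
  unfolding classes_le_def
proof (intro allI impI)
  fix xs assume *: "small \<delta> X" "set xs \<subseteq> X" "successively (gap \<delta> X) xs"
  show "length xs \<le> Suc 0"
  proof (cases xs rule: remdups_adj.cases)
    case (3 x y zs)
    then have "\<not> small \<delta> (X \<inter> {x<..<y})"
      using *(3) by (simp add: gap_def)
    then show ?thesis
      using small_subset[OF *(1)] by blast
  qed auto
qed

lemma rank_le_mono:
  assumes "rank_le \<gamma> X" "\<gamma> \<le> \<delta>"
  shows "rank_le \<delta> X"
proof (cases "\<gamma> = \<delta>")
  case False
  then have "small \<delta> X"
    using assms by (auto simp: small_def intro!: exI[of _ \<gamma>])
  then show ?thesis
    using classes_le_Suc_0_of_small rank_le_iff by blast
qed (use assms in simp)

text \<open>A chain is cut at its first point outside \<open>A\<close>. An interval between two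
  points of the same side stays within that side, so both halves are chains in their own
  sets.\<close>

lemma classes_le_Un:
  assumes A: "classes_le \<delta> m A" and B: "classes_le \<delta> n B" and AB: "\<And>a b. a \<in> A \<Longrightarrow> b \<in> B \<Longrightarrow> a < b"
  shows "classes_le \<delta> (m + n) (A \<union> B)"
  unfolding classes_le_def
proof (intro allI impI)
  fix xs assume xs: "set xs \<subseteq> A \<union> B" "successively (gap \<delta> (A \<union> B)) xs"
  define ys where "ys = takeWhile (\<lambda>x. x \<in> A) xs"
  define zs where "zs = dropWhile (\<lambda>x. x \<in> A) xs"
  have split: "xs = ys @ zs"
    by (simp add: ys_def zs_def)
  have ysA: "set ys \<subseteq> A"
    by (auto simp: ys_def dest: set_takeWhileD)
  have succ: "successively (gap \<delta> (A \<union> B)) ys" "successively (gap \<delta> (A \<union> B)) zs"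
    using xs(2) unfolding split successively_append_iff by blast+
  have "successively (gap \<delta> A) ys"
  proof (rule successively_mono[OF succ(1)])
    fix x y assume "x \<in> set ys" "y \<in> set ys" and g: "gap \<delta> (A \<union> B) x y"
    then have "y \<in> A"
      using ysA by blast
    then have "(A \<union> B) \<inter> {x<..<y} = A \<inter> {x<..<y}"
      using AB[OF \<open>y \<in> A\<close>] by fastforce
    then show "gap \<delta> A x y"
      using g by (simp add: gap_def)
  qed
  then have ys: "length ys \<le> m"
    using A ysA by (simp add: classes_le_def)
  have zsB: "set zs \<subseteq> B"
  proof (cases zs)
    case (Cons z zs')
    have z: "z \<notin> A"
      using Cons hd_dropWhile[of "\<lambda>x. x \<in> A" xs] by (simp add: zs_def)
    have "successively (<) zs"
      by (rule successively_mono[OF succ(2)]) (simp add: gap_def)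
    then have "\<forall>w\<in>set zs'. z < w"
      using Cons successively_conv_sorted_wrt[of "(<)" zs] by (simp add: transp_on_less)
    then have "set zs \<inter> A = {}" if "z \<in> B"
      using Cons z by (auto dest: AB[OF _ that] less_asym)
    moreover have "z \<in> B"
      using z Cons xs(1) split by auto
    ultimately show ?thesis
      using xs(1) split by auto
  qed simp
  have "successively (gap \<delta> B) zs"
  proof (rule successively_mono[OF succ(2)])
    fix x y assume "x \<in> set zs" "y \<in> set zs" and g: "gap \<delta> (A \<union> B) x y"
    then have "x \<in> B"
      using zsB by blast
    then have "(A \<union> B) \<inter> {x<..<y} = B \<inter> {x<..<y}"
      using AB[OF _ \<open>x \<in> B\<close>] by fastforce
    then show "gap \<delta> B x y"
      using g by (simp add: gap_def)
  qed
  then have "length zs \<le> n"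
    using B zsB by (simp add: classes_le_def)
  then show "length xs \<le> m + n"
    using ys split by simp
qed

lemma rank_le_Un:
  assumes "rank_le \<delta> A" "rank_le \<delta> B" "\<And>a b. a \<in> A \<Longrightarrow> b \<in> B \<Longrightarrow> a < b"
  shows "rank_le \<delta> (A \<union> B)"
  using assms classes_le_Un[of \<delta> _ A _ B] unfolding rank_le_iff by blast

lemma small_Un:
  assumes "small \<delta> A" "small \<delta> B" "\<And>a b. a \<in> A \<Longrightarrow> b \<in> B \<Longrightarrow> a < b"
  shows "small \<delta> (A \<union> B)"
proof -
  obtain \<beta> \<gamma> where "\<beta> < \<delta>" "rank_le \<beta> A" "\<gamma> < \<delta>" "rank_le \<gamma> B"
    using assms(1,2) by (auto simp: small_def)
  then have "rank_le (max \<beta> \<gamma>) A" "rank_le (max \<beta> \<gamma>) B" "max \<beta> \<gamma> < \<delta>"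
    by (auto intro: rank_le_mono)
  then show ?thesis
    using rank_le_Un assms(3) unfolding small_def by blast
qed

lemma rank_le_finite:
  assumes "finite X"
  shows "rank_le \<delta> X"
proof -
  have "length xs \<le> card X" if xs: "set xs \<subseteq> X" "successively (gap \<delta> X) xs" for xs
  proof -
    have "successively (<) xs"
      by (rule successively_mono[OF xs(2)]) (simp add: gap_def)
    then have "distinct xs"
      using successively_conv_sorted_wrt[of "(<)" xs] strict_sorted_iff[of xs]
      by (simp add: transp_on_less)
    then show ?thesis
      using assms xs(1) by (metis card_mono distinct_card)
  qed
  then show ?thesis
    unfolding rank_le_iff classes_le_def by blast
qed

lemma small_split:
  assumes "small \<alpha> (X \<inter> {..<x})" "small \<alpha> (X \<inter> {x<..})"
  shows "small \<alpha> X"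
proof -
  \<comment> \<open>A singleton is small only if some ordinal lies below \<alpha>; the smallness of
    the initial segment supplies one.\<close>
  have "small \<alpha> {x}"
    using assms(1) rank_le_finite[of "{x}"] by (auto simp: small_def)
  then have "small \<alpha> (X \<inter> {..<x} \<union> {x})"
    by (intro small_Un assms(1)) auto
  then have "small \<alpha> (X \<inter> {..<x} \<union> {x} \<union> X \<inter> {x<..})"
    by (rule small_Un[OF _ assms(2)]) auto
  then show ?thesis
    by (rule small_subset) auto
qed

section \<open>Short sets, and cutting a set of bounded rank into short pieces\<close>

definition short :: "cord \<Rightarrow> 'a::linorder set \<Rightarrow> bool" where
  "short \<alpha> X \<longleftrightarrow> (\<forall>x\<in>X. small \<alpha> (X \<inter> {..<x}) \<or> small \<alpha> (X \<inter> {x<..}))"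

lemma short_subset: "short \<alpha> X \<Longrightarrow> Y \<subseteq> X \<Longrightarrow> short \<alpha> Y"
  unfolding short_def by (meson Int_mono order_refl small_subset subsetD)

text \<open>A chain of maximal length meets the leftmost class in its first element.\<close>

lemma leftmost_class:
  assumes "classes_le \<delta> n X" "X \<noteq> {}"
  obtains b m where "b \<in> X" "\<And>x. x \<in> X \<Longrightarrow> x < b \<Longrightarrow> small \<delta> (X \<inter> {x<..<b})"
    "\<And>xs. set xs \<subseteq> X \<Longrightarrow> successively (gap \<delta> X) (b # xs) \<Longrightarrow> length xs \<le> m"
proof -
  define ch where "ch xs \<longleftrightarrow> set xs \<subseteq> X \<and> successively (gap \<delta> X) xs \<and> xs \<noteq> []" for xs
  have bound: "length xs \<le> n" if "ch xs" for xs
    using that assms(1) by (simp add: ch_def classes_le_def)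
  obtain x where "x \<in> X"
    using assms(2) by blast
  then have "ch [x]"
    by (simp add: ch_def)
  then have "\<exists>xs. ch xs \<and> (\<forall>ys. ch ys \<longrightarrow> length ys \<le> length xs)"
    using ex_has_greatest_nat[of ch "[x]" length "Suc n"] bound by (auto simp: less_Suc_eq_le)
  then obtain xs where xs: "ch xs" "\<And>ys. ch ys \<Longrightarrow> length ys \<le> length xs"
    by blast
  then obtain b xs' where b: "xs = b # xs'"
    by (cases xs) (auto simp: ch_def)
  show ?thesis
  proof (rule that[of b n])
    show "b \<in> X"
      using xs(1) b by (simp add: ch_def)
    show "small \<delta> (X \<inter> {x<..<b})" if "x \<in> X" "x < b" for x
    proof (rule ccontr)
      assume "\<not> ?thesis"
      then have "ch (x # xs)"
        using that xs(1) b by (simp add: ch_def gap_def)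
      from xs(2)[OF this] show False
        by simp
    qed
    show "length ys \<le> n" if "set ys \<subseteq> X" "successively (gap \<delta> X) (b # ys)" for ys
      using bound[of "b # ys"] that \<open>b \<in> X\<close> by (simp add: ch_def)
  qed
qed

text \<open>Adds the cut point \<open>c\<close> to a decomposition of the part above it. An index
  set containing \<open>c\<close> selects a piece of that part, and one omitting \<open>c\<close>
  selects a piece below \<open>c\<close>.\<close>

lemma decompose_Cons:
  assumes "c \<in> X" "short \<delta> (X \<inter> {..<c})" "finite F" "F \<subseteq> X \<inter> {c<..}"
    and "\<And>G. G \<subseteq> F \<Longrightarrow> short \<delta> (between G (F - G) (X \<inter> {c<..}))"
  shows "\<exists>F. finite F \<and> F \<subseteq> X \<and> (\<forall>G\<subseteq>F. short \<delta> (between G (F - G) X))"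
proof (intro exI conjI allI impI)
  show "finite (insert c F)" "insert c F \<subseteq> X"
    using assms by auto
  fix G assume G: "G \<subseteq> insert c F"
  show "short \<delta> (between G (insert c F - G) X)"
  proof (cases "c \<in> G")
    case True
    then have "between G (insert c F - G) X \<subseteq> between (G \<inter> F) (F - G \<inter> F) (X \<inter> {c<..})"
      by (auto simp: between_def)
    then show ?thesis
      using assms(5)[of "G \<inter> F"] short_subset by blast
  next
    case False
    then have "between G (insert c F - G) X \<subseteq> X \<inter> {..<c}"
      by (auto simp: between_def)
    then show ?thesis
      using assms(2) short_subset by blast
  qed
qed

text \<open>Induction on the number of classes that can still follow \<open>c\<close>. If a chain of
  the full length \<open>Suc n\<close> follows \<open>c\<close>, its first point \<open>x\<close>
  becomes a cut point, and above \<open>x\<close> the bound drops to \<open>n\<close>. When no point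
  can follow, every point above \<open>c\<close> spans a small interval with
  \<open>c\<close>.\<close>

lemma decompose_right:
  assumes "\<And>xs. set xs \<subseteq> X \<Longrightarrow> successively (gap \<delta> X) (c # xs) \<Longrightarrow> length xs \<le> n"
  shows "\<exists>F. finite F \<and> F \<subseteq> X \<inter> {c<..} \<and> (\<forall>G\<subseteq>F. short \<delta> (between G (F - G) (X \<inter> {c<..})))"
  using assms
proof (induction n arbitrary: c)
  case 0
  have "small \<delta> (X \<inter> {c<..<x})" if "x \<in> X" "c < x" for x
    using 0[of "[x]"] that by (auto simp: gap_def)
  moreover have "X \<inter> {c<..} \<inter> {..<x} = X \<inter> {c<..<x}" for x
    by auto
  ultimately have "short \<delta> (X \<inter> {c<..})"
    by (simp add: short_def)
  then show ?case
    by (intro exI[of _ "{}"]) auto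
next
  case (Suc n)
  show ?case
  proof (cases "\<exists>xs. set xs \<subseteq> X \<and> successively (gap \<delta> X) (c # xs) \<and> length xs = Suc n")
    case True
    then obtain x xs where xs: "set (x # xs) \<subseteq> X" "successively (gap \<delta> X) (c # x # xs)" "length xs = n"
      by (auto simp: length_Suc_conv)
    have "length ys \<le> n" if "set ys \<subseteq> X" "successively (gap \<delta> X) (x # ys)" for ys
      using Suc.prems[of "x # ys"] that xs by simp
    from Suc.IH[of x, OF this] obtain F where F: "finite F" "F \<subseteq> X \<inter> {x<..}"
      "\<And>G. G \<subseteq> F \<Longrightarrow> short \<delta> (between G (F - G) (X \<inter> {x<..}))"
      by blast
    \<comment> \<open>Otherwise \<open>y\<close> could be inserted between \<open>c\<close> and
      \<open>x\<close>, making the chain longer than the bound allows.\<close>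
    have "small \<delta> (X \<inter> {c<..<y}) \<or> small \<delta> (X \<inter> {y<..<x})" if "y \<in> X" "c < y" "y < x" for y
      using Suc.prems[of "y # x # xs"] that xs by (auto simp: gap_def)
    moreover have "X \<inter> {c<..} \<inter> {..<x} \<inter> {..<y} = X \<inter> {c<..<y}"
      "X \<inter> {c<..} \<inter> {..<x} \<inter> {y<..} = X \<inter> {y<..<x}" if "c < y" "y < x" for y
      using that by auto
    ultimately have "short \<delta> (X \<inter> {c<..} \<inter> {..<x})"
      by (simp add: short_def)
    moreover have "c < x"
      using xs(2) by (simp add: gap_def)
    moreover from this have "X \<inter> {c<..} \<inter> {x<..} = X \<inter> {x<..}"
      by auto
    ultimately show ?thesis
      using decompose_Cons[of x "X \<inter> {c<..}" \<delta> F] F xs(1) by simp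
  next
    case False
    show ?thesis
    proof (rule Suc.IH)
      show "length xs \<le> n" if "set xs \<subseteq> X" "successively (gap \<delta> X) (c # xs)" for xs
        using Suc.prems[OF that] False that by (auto simp: le_Suc_eq)
    qed
  qed
qed

text \<open>There are finitely many condensation classes. A point of the leftmost one is the first
  cut point: all intervals ending there are small, so the part below it is short.\<close>

lemma decompose:
  assumes "rank_le \<delta> X"
  obtains F where "finite F" "F \<subseteq> X" "\<And>G. G \<subseteq> F \<Longrightarrow> short \<delta> (between G (F - G) X)"
proof (cases "X = {}")
  case True
  then show ?thesis
    using that[of "{}"] by (auto simp: short_def)
next
  case False
  obtain n where "classes_le \<delta> n X"
    using assms by (auto simp: rank_le_iff)
  then obtain b m where b: "b \<in> X" "\<And>x. x \<in> X \<Longrightarrow> x < b \<Longrightarrow> small \<delta> (X \<inter> {x<..<b})"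
    "\<And>xs. set xs \<subseteq> X \<Longrightarrow> successively (gap \<delta> X) (b # xs) \<Longrightarrow> length xs \<le> m"
    using leftmost_class[OF _ False] by metis
  have "X \<inter> {..<b} \<inter> {x<..} = X \<inter> {x<..<b}" for x
    by auto
  then have "short \<delta> (X \<inter> {..<b})"
    using b(2) by (simp add: short_def)
  moreover from decompose_right[of X \<delta> b m, OF b(3)] obtain F where
    F: "finite F" "F \<subseteq> X \<inter> {b<..}" "\<And>G. G \<subseteq> F \<Longrightarrow> short \<delta> (between G (F - G) (X \<inter> {b<..}))"
    by blast
  ultimately obtain F where "finite F" "F \<subseteq> X" "\<forall>G\<subseteq>F. short \<delta> (between G (F - G) X)"
    using decompose_Cons[OF b(1) _ F] by blast
  then show ?thesis
    using that by blast
qed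

section \<open>Recovering a set from the isomorphism types of its final segments\<close>

text \<open>
  Each point is labelled with the bounds that hold for the tail above it.  Labels are invariant under
  isomorphisms of tails and every set of points with a fixed label lies inside a proper tail, so the
  isomorphisms obtained for the individual labels agree with each other about the labels and can be pasted.
\<close>

lemma similar_of_same_tails:
  fixes L L' :: "'a::linorder set"
  assumes right: "\<And>x. x \<in> L \<Longrightarrow> \<exists>y\<in>L'. similar (L \<inter> {x<..}) (L' \<inter> {y<..})"
    and left: "\<And>y. y \<in> L' \<Longrightarrow> \<exists>x\<in>L. similar (L \<inter> {x<..}) (L' \<inter> {y<..})"
    and small: "\<And>x. x \<in> L \<Longrightarrow> small \<delta> (L \<inter> {x<..})"
    and not_small: "\<not> small \<delta> L"
  shows "similar L L'"
proof -
  define p where "p K x = {(\<gamma>, n). \<gamma> < \<delta> \<and> classes_le \<gamma> n (K \<inter> {x<..})}" for K :: "'a set" and x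
  have p_mono: "p K x \<subseteq> p K y" if "x \<le> y" for K x y
    using that by (auto simp: p_def intro: classes_le_subset)
  have p_similar: "p K x = p K' y" if "similar (K \<inter> {x<..}) (K' \<inter> {y<..})" for K K' x y
    using classes_le_similar[OF that] classes_le_similar[OF similar_sym[OF that]] by (auto simp: p_def)
  \<comment> \<open>An isomorphism of tails restricts to the tails above \<open>x\<close> and
    \<open>g x\<close>, so it preserves labels.\<close>
  have p_image: "p L x = p L' (g x)"
    if g: "strict_mono_on (L \<inter> {a<..}) g" "g ` (L \<inter> {a<..}) = L' \<inter> {b<..}" and x: "x \<in> L" "a < x" for g a b x
  proof (rule p_similar, rule similarI)
    show "strict_mono_on (L \<inter> {x<..}) g"
      by (rule monotone_on_subset[OF g(1)]) (use x in auto)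
    have lt: "g x < g z \<longleftrightarrow> x < z" if "z \<in> L" "a < z" for z
      using strict_mono_on_less_iff[OF g(1), of x z] that x by simp
    have gx: "g x \<in> L' \<inter> {b<..}"
      using g(2) x by blast
    show "g ` (L \<inter> {x<..}) = L' \<inter> {g x<..}"
    proof
      show "g ` (L \<inter> {x<..}) \<subseteq> L' \<inter> {g x<..}"
      proof
        fix w assume "w \<in> g ` (L \<inter> {x<..})"
        then obtain z where z: "z \<in> L" "x < z" "w = g z"
          by auto
        then have "g z \<in> L' \<inter> {b<..}"
          using g(2) x by auto
        then show "w \<in> L' \<inter> {g x<..}"
          using lt[of z] z x by auto
      qed
      show "L' \<inter> {g x<..} \<subseteq> g ` (L \<inter> {x<..})"
      proof
        fix w assume w: "w \<in> L' \<inter> {g x<..}"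
        then have "w \<in> g ` (L \<inter> {a<..})"
          using g(2) gx by auto
        then obtain z where z: "z \<in> L" "a < z" "w = g z"
          by auto
        then show "w \<in> g ` (L \<inter> {x<..})"
          using lt[of z] w by auto
      qed
    qed
  qed
  have p_nonempty: "p L x \<noteq> {}" if "x \<in> L" for x
    using small[OF that] by (auto simp: p_def small_def rank_le_iff)
  \<comment> \<open>If every proper tail had at most \<open>n\<close> classes at level \<gamma>,
    then \<open>L\<close> would have at most \<open>Suc n\<close>: all but the first point of a
    chain lie in the tail above that first point. Then \<open>L\<close> would be small.\<close>
  have p_outside: "\<exists>x\<in>L. (\<gamma>, n) \<notin> p L x" if "\<gamma> < \<delta>" for \<gamma> n
  proof (rule ccontr)
    assume "\<not> ?thesis"
    then have tail: "classes_le \<gamma> n (L \<inter> {x<..})" if "x \<in> L" for x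
      using that by (auto simp: p_def)
    have "length xs \<le> Suc n" if xs: "set xs \<subseteq> L" "successively (gap \<gamma> L) xs" for xs
    proof (cases xs)
      case (Cons x ys)
      have "successively (<) xs"
        by (rule successively_mono[OF xs(2)]) (simp add: gap_def)
      then have above: "\<forall>w\<in>set ys. x < w"
        using Cons successively_conv_sorted_wrt[of "(<)" xs] by simp
      have "successively (gap \<gamma> L) ys"
        using xs(2) Cons by (cases ys) simp_all
      then have "successively (gap \<gamma> (L \<inter> {x<..})) ys"
      proof (rule successively_mono)
        fix u v assume "u \<in> set ys" "v \<in> set ys" and uv: "gap \<gamma> L u v"
        then have "x < u"
          using above by blast
        then have "L \<inter> {x<..} \<inter> {u<..<v} = L \<inter> {u<..<v}"
          by auto
        with uv show "gap \<gamma> (L \<inter> {x<..}) u v"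
          by (simp add: gap_def)
      qed
      moreover have "set ys \<subseteq> L \<inter> {x<..}"
        using above Cons xs(1) by auto
      ultimately have "length ys \<le> n"
        using tail[of x] Cons xs(1) by (simp add: classes_le_def)
      then show ?thesis
        using Cons by simp
    qed simp
    then have "rank_le \<gamma> L"
      unfolding rank_le_iff classes_le_def by blast
    then show False
      using not_small that by (auto simp: small_def)
  qed
  \<comment> \<open>Labels grow with the point, so a label not contained in that of \<open>a\<close>
    occurs only above \<open>a\<close>; the map \<open>g\<close> is thus defined on all points with
    label \<open>P\<close>.\<close>
  define good where "good P g \<longleftrightarrow> (\<exists>a\<in>L. \<exists>b\<in>L'. strict_mono_on (L \<inter> {a<..}) g \<and>
      g ` (L \<inter> {a<..}) = L' \<inter> {b<..} \<and> \<not> P \<subseteq> p L a)" for P and g :: "'a \<Rightarrow> 'a"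
  \<comment> \<open>The choice depends on the label alone, so points with equal labels are moved by
    one and the same isomorphism.\<close>
  define g where "g P = (SOME g. good P g)" for P
  have g: "good (p L x) (g (p L x))" if xL: "x \<in> L" for x
  proof -
    obtain \<gamma> n where \<gamma>: "(\<gamma>, n) \<in> p L x"
      using p_nonempty[OF xL] by auto
    then obtain a where a: "a \<in> L" "(\<gamma>, n) \<notin> p L a"
      using p_outside[of \<gamma> n] by (auto simp: p_def)
    obtain b where b: "b \<in> L'" "similar (L \<inter> {a<..}) (L' \<inter> {b<..})"
      using right[OF a(1)] by blast
    then obtain k where k: "strict_mono_on (L \<inter> {a<..}) k" "k ` (L \<inter> {a<..}) = L' \<inter> {b<..}"
      by (auto simp: similar_def)
    have "good (p L x) k"
      unfolding good_def by (rule bexI[OF _ a(1)], rule bexI[OF _ b(1)]) (use k a(2) \<gamma> in auto)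
    then show ?thesis
      unfolding g_def by (rule someI[where P = "good (p L x)"])
  qed
  define h where "h x = g (p L x) x" for x
  have h: "h x \<in> L'" "p L' (h x) = p L x" if xL: "x \<in> L" for x
  proof -
    obtain a b where ab: "a \<in> L" "b \<in> L'" "strict_mono_on (L \<inter> {a<..}) (g (p L x))"
      "g (p L x) ` (L \<inter> {a<..}) = L' \<inter> {b<..}" "\<not> p L x \<subseteq> p L a"
      using g[OF xL] unfolding good_def by blast
    then have "a < x"
      using p_mono[of x a L] by (meson not_less)
    then show "p L' (h x) = p L x"
      using p_image[OF ab(3,4) xL] by (simp add: h_def)
    have "g (p L x) x \<in> L' \<inter> {b<..}"
      using ab(4) \<open>a < x\<close> xL by blast
    then show "h x \<in> L'"
      by (simp add: h_def)
  qed
  show ?thesis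
  proof (rule similarI)
    show "strict_mono_on L h"
    proof (rule strict_mono_onI)
      fix x y assume xy: "x \<in> L" "y \<in> L" "x < y"
      show "h x < h y"
      proof (cases "p L x = p L y")
        case True
        obtain a b where ab: "strict_mono_on (L \<inter> {a<..}) (g (p L x))" "\<not> p L x \<subseteq> p L a"
          using g[OF xy(1)] unfolding good_def by blast
        then have "a < x"
          using p_mono[of x a L] by (meson not_less)
        then show ?thesis
          using strict_mono_onD[OF ab(1), of x y] xy True by (simp add: h_def)
      next
        case False
        \<comment> \<open>Points with different labels are moved by unrelated maps, but
          \<open>h\<close> preserves labels and labels increase with the point, which fixes the
          order of the images.\<close>
        then have "\<not> p L' (h y) \<subseteq> p L' (h x)"
          using p_mono[OF less_imp_le[OF xy(3)], of L] h(2)[OF xy(1)] h(2)[OF xy(2)] by simp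
        then show ?thesis
          using p_mono[of "h y" "h x" L'] by (meson not_less)
      qed
    qed
    show "h ` L = L'"
    proof
      show "h ` L \<subseteq> L'"
        using h by auto
      show "L' \<subseteq> h ` L"
      proof
        fix y assume y: "y \<in> L'"
        obtain x1 where x1: "x1 \<in> L" "similar (L \<inter> {x1<..}) (L' \<inter> {y<..})"
          using left[OF y] by blast
        have P: "p L' y = p L x1"
          using p_similar[OF x1(2)] by simp
        obtain a b where ab: "a \<in> L" "b \<in> L'" "strict_mono_on (L \<inter> {a<..}) (g (p L x1))"
          "g (p L x1) ` (L \<inter> {a<..}) = L' \<inter> {b<..}" "\<not> p L x1 \<subseteq> p L a"
          using g[OF x1(1)] unfolding good_def by blast
        \<comment> \<open>The label of \<open>y\<close> also occurs in \<open>L\<close>, and it is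
          not contained in that of \<open>b\<close>. Hence \<open>y\<close> lies above
          \<open>b\<close>, in the range of the map chosen for this label, and its preimage carries
          the same label.\<close>
        have "p L a = p L' b"
          using ab(3,4) by (intro p_similar similarI)
        then have "b < y"
          using p_mono[of y b L'] ab(5) P by (metis not_less)
        then have "y \<in> g (p L x1) ` (L \<inter> {a<..})"
          using ab(4) y by auto
        then obtain x where x: "x \<in> L" "a < x" "y = g (p L x1) x"
          by auto
        then have "y = h x"
          using p_image[OF ab(3,4) x(1,2)] P by (simp add: h_def)
        then show "y \<in> h ` L"
          using x(1) by blast
      qed
    qed
  qed
qed

section \<open>The back-and-forth game\<close>

text \<open>
  The tuple chosen in \<open>Y\<close> is a finite set \<open>F\<close>, and the intervals it cuts out are indexed by the
  subsets \<open>G\<close> of \<open>F\<close> below them; if \<open>G\<close> is not an initial segment of \<open>F\<close>, both intervals are empty.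
\<close>

function bf :: "cord \<Rightarrow> 'a::linorder set \<Rightarrow> 'a set \<Rightarrow> bool" where
  "bf \<beta> X Y \<longleftrightarrow> (\<forall>\<gamma>\<in>{..<\<beta>}. \<forall>F. finite F \<and> F \<subseteq> Y \<longrightarrow>
     (\<exists>f. strict_mono_on F f \<and> f ` F \<subseteq> X \<and>
       (\<forall>G. G \<subseteq> F \<longrightarrow> bf \<gamma> (between G (F - G) Y) (between (f ` G) (f ` (F - G)) X))))"
  by auto
termination
  by (relation "inv_image {(x, y). x < y} fst") (auto simp: wf_cord)

declare bf.simps [simp del]

lemma bfE:
  assumes "bf \<beta> X Y" "\<gamma> < \<beta>" "finite F" "F \<subseteq> Y"
  obtains f where "strict_mono_on F f" "f ` F \<subseteq> X"
    "\<And>G. G \<subseteq> F \<Longrightarrow> bf \<gamma> (between G (F - G) Y) (between (f ` G) (f ` (F - G)) X)"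
proof -
  have "\<exists>f. strict_mono_on F f \<and> f ` F \<subseteq> X \<and>
       (\<forall>G. G \<subseteq> F \<longrightarrow> bf \<gamma> (between G (F - G) Y) (between (f ` G) (f ` (F - G)) X))"
    using assms unfolding bf.simps[of \<beta>] by simp
  then show ?thesis
    using that by metis
qed

lemma bf_mono:
  assumes "bf \<beta> X Y" "\<gamma> \<le> \<beta>"
  shows "bf \<gamma> X Y"
proof -
  have "{..<\<gamma>} \<subseteq> {..<\<beta>}"
    using assms(2) by auto
  then show ?thesis
    using assms(1) unfolding bf.simps[of \<beta>] bf.simps[of \<gamma>] by (meson subsetD)
qed

text \<open>A move with no points chosen exchanges the two sides at the cost of lowering the
  level.\<close>

lemma bf_flip:
  assumes "bf \<beta> X Y" "\<gamma> < \<beta>"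
  shows "bf \<gamma> Y X"
proof (rule bfE[OF assms, of "{}"])
  fix f :: "'a \<Rightarrow> 'a"
  assume "\<And>G. G \<subseteq> {} \<Longrightarrow> bf \<gamma> (between G ({} - G) Y) (between (f ` G) (f ` ({} - G)) X)"
  from this[of "{}"] show ?thesis
    by simp
qed auto

lemma bf_point:
  assumes "bf \<beta> X Y" "\<gamma> < \<beta>" "b \<in> Y"
  obtains a where "a \<in> X" "bf \<gamma> (Y \<inter> {..<b}) (X \<inter> {..<a})" "bf \<gamma> (Y \<inter> {b<..}) (X \<inter> {a<..})"
proof (rule bfE[OF assms(1,2), of "{b}"])
  fix f :: "'a \<Rightarrow> 'a"
  assume *: "f ` {b} \<subseteq> X"
    "\<And>G. G \<subseteq> {b} \<Longrightarrow> bf \<gamma> (between G ({b} - G) Y) (between (f ` G) (f ` ({b} - G)) X)"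
  from *(2)[of "{}"] *(2)[of "{b}"] *(1) that[of "f b"] show ?thesis
    by (simp add: between_below between_above)
qed (use assms in auto)

section \<open>Reversal of the order by negation\<close>

lemma between_uminus:
  fixes X :: "'a::linordered_ab_group_add set"
  shows "between G H (uminus ` X) = uminus ` between (uminus ` H) (uminus ` G) X"
  by (force simp: between_def image_iff minus_less_iff less_minus_iff)

text \<open>Allows initial segments to be handled as final segments. Reversal exchanges the cut
  points below a piece with those above it, so the piece indexed by \<open>G\<close> comes from the
  one indexed by the negatives of \<open>F - G\<close>.\<close>

lemma bf_uminus:
  fixes X Y :: "'a::linordered_ab_group_add set"
  assumes "bf \<beta> X Y"
  shows "bf \<beta> (uminus ` X) (uminus ` Y)"
  using assms
proof (induction \<beta> arbitrary: X Y rule: less_induct)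
  case (less \<beta>)
  show ?case
    unfolding bf.simps[of \<beta>]
  proof (intro ballI allI impI)
    fix \<gamma> F assume \<gamma>: "\<gamma> \<in> {..<\<beta>}" and F: "finite F \<and> F \<subseteq> uminus ` Y"
    have F': "finite (uminus ` F)" "uminus ` F \<subseteq> Y"
      using F by auto
    from \<gamma> have "\<gamma> < \<beta>"
      by simp
    from bfE[OF less.prems this F'] obtain f where f: "strict_mono_on (uminus ` F) f" "f ` uminus ` F \<subseteq> X"
      "\<And>G. G \<subseteq> uminus ` F \<Longrightarrow> bf \<gamma> (between G (uminus ` F - G) Y) (between (f ` G) (f ` (uminus ` F - G)) X)"
      by metis
    show "\<exists>f. strict_mono_on F f \<and> f ` F \<subseteq> uminus ` X \<and> (\<forall>G. G \<subseteq> F \<longrightarrow>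
        bf \<gamma> (between G (F - G) (uminus ` Y)) (between (f ` G) (f ` (F - G)) (uminus ` X)))"
    proof (intro exI[of _ "\<lambda>x. - f (- x)"] conjI allI impI)
      show "strict_mono_on F (\<lambda>x. - f (- x))"
        using f(1) by (auto simp: strict_mono_on_def)
      show "(\<lambda>x. - f (- x)) ` F \<subseteq> uminus ` X"
        using f(2) by auto
      fix G assume G: "G \<subseteq> F"
      have "uminus ` F - uminus ` (F - G) = uminus ` G"
        using G by (auto simp: image_iff)
      moreover have "uminus ` (\<lambda>x. - f (- x)) ` H = f ` uminus ` H" for H
        by (simp add: image_image)
      ultimately have "bf \<gamma> (between (uminus ` (F - G)) (uminus ` G) Y)
          (between (uminus ` (\<lambda>x. - f (- x)) ` (F - G)) (uminus ` (\<lambda>x. - f (- x)) ` G) X)"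
        using f(3)[of "uminus ` (F - G)"] by (simp add: image_mono)
      from less.IH[OF \<open>\<gamma> < \<beta>\<close> this]
      show "bf \<gamma> (between G (F - G) (uminus ` Y))
          (between ((\<lambda>x. - f (- x)) ` G) ((\<lambda>x. - f (- x)) ` (F - G)) (uminus ` X))"
        unfolding between_uminus .
    qed
  qed
qed

text \<open>The negatives of a chain, listed backwards, form a chain of the same length.\<close>

lemma rank_le_uminus:
  fixes X :: "'a::linordered_ab_group_add set"
  assumes "rank_le \<delta> X"
  shows "rank_le \<delta> (uminus ` X)"
  using assms
proof (induction \<delta> arbitrary: X rule: less_induct)
  case (less \<delta>)
  obtain n where n: "classes_le \<delta> n X"
    using less.prems by (auto simp: rank_le_iff)
  have "length xs \<le> n" if xs: "set xs \<subseteq> uminus ` X" "successively (gap \<delta> (uminus ` X)) xs" for xs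
  proof -
    have "successively (\<lambda>x y. gap \<delta> X (- y) (- x)) xs"
    proof (rule successively_mono[OF xs(2)])
      fix x y assume g: "gap \<delta> (uminus ` X) x y"
      have "uminus ` (X \<inter> {- y<..<- x}) = uminus ` X \<inter> {x<..<y}"
        by (force simp: image_iff minus_less_iff less_minus_iff)
      then have "small \<delta> (uminus ` X \<inter> {x<..<y})" if "small \<delta> (X \<inter> {- y<..<- x})"
        using that less.IH unfolding small_def by metis
      then show "gap \<delta> X (- y) (- x)"
        using g by (auto simp: gap_def)
    qed
    then have "successively (gap \<delta> X) (map uminus (rev xs))"
      by (simp add: successively_map)
    moreover have "set (map uminus (rev xs)) \<subseteq> X"
      using xs(1) by auto
    ultimately have "length (map uminus (rev xs)) \<le> n"
      using n unfolding classes_le_def by blast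
    then show ?thesis
      by simp
  qed
  then show ?case
    unfolding rank_le_iff classes_le_def by blast
qed

lemma small_uminus:
  fixes X :: "'a::linordered_ab_group_add set"
  shows "small \<delta> (uminus ` X) \<longleftrightarrow> small \<delta> X"
  using rank_le_uminus[of _ X] rank_le_uminus[of _ "uminus ` X"] by (auto simp: small_def image_image)

lemma similar_uminus:
  fixes X Y :: "'a::linordered_ab_group_add set"
  assumes "similar (uminus ` X) (uminus ` Y)"
  shows "similar X Y"
proof -
  obtain h where h: "strict_mono_on (uminus ` X) h" "h ` uminus ` X = uminus ` Y"
    using assms by (auto simp: similar_def)
  show ?thesis
  proof (rule similarI)
    show "strict_mono_on X (\<lambda>x. - h (- x))"
      using h(1) by (auto simp: strict_mono_on_def)
    have "(\<lambda>x. - h (- x)) ` X = uminus ` h ` uminus ` X"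
      by (simp add: image_image)
    also have "\<dots> = Y"
      unfolding h(2) by (simp add: image_image)
    finally show "(\<lambda>x. - h (- x)) ` X = Y" .
  qed
qed

section \<open>Rigidity of short sets\<close>

definition short_rigid :: "cord \<Rightarrow> bool" where
  "short_rigid \<alpha> \<longleftrightarrow> (\<forall>X Y :: real set. short \<alpha> X \<longrightarrow> bf (osucc (odouble \<alpha>)) X Y \<longrightarrow> similar X Y)"

text \<open>Level 2\<alpha> is at least 2\<epsilon>+2, so one move can be made at level 2\<alpha>
  before the rigidity of short sets at \<epsilon> is applied at 2\<epsilon>+1.\<close>

lemma osucc_odouble_less: "\<epsilon> < \<alpha> \<Longrightarrow> osucc (odouble \<epsilon>) < odouble \<alpha>"
  using odouble_le_iff[of \<alpha> "odouble \<alpha>"] by (simp add: osucc_le_iff)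

text \<open>The extra level pays for one move, in which the cut points of a decomposition of
  \<open>Y\<close> are played. Afterwards the short pieces of \<open>Y\<close> stand on the left, as
  \<open>short_rigid\<close> requires.\<close>

lemma rank_rigid:
  fixes X Y :: "real set"
  assumes rigid: "short_rigid \<alpha>" and Y: "rank_le \<alpha> Y" and bf: "bf (osucc (osucc (odouble \<alpha>))) X Y"
  shows "similar X Y"
proof -
  obtain F where F: "finite F" "F \<subseteq> Y" "\<And>G. G \<subseteq> F \<Longrightarrow> short \<alpha> (between G (F - G) Y)"
    using decompose[OF Y] by metis
  obtain f where f: "strict_mono_on F f" "f ` F \<subseteq> X"
    "\<And>G. G \<subseteq> F \<Longrightarrow> bf (osucc (odouble \<alpha>)) (between G (F - G) Y) (between (f ` G) (f ` (F - G)) X)"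
    using bfE[OF bf less_osucc F(1,2)] by metis
  have "similar Y X"
  proof (rule similar_glue[OF f(1) F(2) f(2)])
    fix G assume "G \<subseteq> F"
    then show "similar (between G (F - G) Y) (between (f ` G) (f ` (F - G)) X)"
      using rigid F(3) f(3) unfolding short_rigid_def by blast
  qed
  then show ?thesis
    by (rule similar_sym)
qed

text \<open>The point \<open>b\<close> and the cut points of the tail above it are played in a
  single move, so any level above 2\<epsilon>+1 suffices. Playing \<open>b\<close> first would use
  up a level that \<open>rank_rigid\<close> still needs.\<close>

lemma match_tail:
  fixes A B :: "real set"
  assumes rigid: "short_rigid \<epsilon>" and bf: "bf \<gamma> A B" "osucc (odouble \<epsilon>) < \<gamma>"
    and b: "b \<in> B" "rank_le \<epsilon> (B \<inter> {b<..})"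
  obtains a where "a \<in> A" "similar (B \<inter> {b<..}) (A \<inter> {a<..})"
proof -
  obtain F where F: "finite F" "F \<subseteq> B \<inter> {b<..}"
    "\<And>G. G \<subseteq> F \<Longrightarrow> short \<epsilon> (between G (F - G) (B \<inter> {b<..}))"
    using decompose[OF b(2)] by metis
  have F': "finite (insert b F)" "insert b F \<subseteq> B"
    using F b by auto
  obtain f where f: "strict_mono_on (insert b F) f" "f ` insert b F \<subseteq> A"
    "\<And>G. G \<subseteq> insert b F \<Longrightarrow>
       bf (osucc (odouble \<epsilon>)) (between G (insert b F - G) B) (between (f ` G) (f ` (insert b F - G)) A)"
    using bfE[OF bf F'] by metis
  have bF: "b \<notin> F"
    using F(2) by auto
  have fb: "f b < f g" if "g \<in> F" for g
    using strict_mono_onD[OF f(1), of b g] that F(2) by auto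
  have "similar (B \<inter> {b<..}) (A \<inter> {f b<..})"
  proof (rule similar_glue[OF _ F(2)])
    show "strict_mono_on F f"
      by (rule monotone_on_subset[OF f(1)]) auto
    show "f ` F \<subseteq> A \<inter> {f b<..}"
      using f(2) fb by auto
    fix G assume G: "G \<subseteq> F"
    have eq: "insert b F - insert b G = F - G"
      using bF by auto
    \<comment> \<open>The pieces of \<open>B\<close> whose index contains \<open>b\<close> are
      exactly the pieces of the tail above \<open>b\<close>.\<close>
    have "between (insert b G) (F - G) B = between G (F - G) (B \<inter> {b<..})"
      "between (f ` insert b G) (f ` (F - G)) A = between (f ` G) (f ` (F - G)) (A \<inter> {f b<..})"
      by (auto simp: between_def)
    then have "bf (osucc (odouble \<epsilon>)) (between G (F - G) (B \<inter> {b<..}))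
        (between (f ` G) (f ` (F - G)) (A \<inter> {f b<..}))"
      using f(3)[of "insert b G"] G unfolding eq by auto
    then show "similar (between G (F - G) (B \<inter> {b<..})) (between (f ` G) (f ` (F - G)) (A \<inter> {f b<..}))"
      using rigid F(3)[OF G] unfolding short_rigid_def by blast
  qed
  then show ?thesis
    using that f(2) by blast
qed

section \<open>Points with a small final segment\<close>

definition right_part :: "cord \<Rightarrow> 'a::linorder set \<Rightarrow> 'a set" where
  "right_part \<alpha> X = {x \<in> X. small \<alpha> (X \<inter> {x<..})}"

text \<open>Final segments shrink as their starting point grows, so the right part is closed upwards
  in \<open>X\<close>.\<close>

lemma right_part_tail:
  assumes "x \<in> right_part \<alpha> X"
  shows "right_part \<alpha> X \<inter> {x<..} = X \<inter> {x<..}"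
proof -
  have "small \<alpha> (X \<inter> {y<..})" if "x < y" for y
    by (rule small_subset[of _ "X \<inter> {x<..}"]) (use assms that in \<open>auto simp: right_part_def\<close>)
  then show ?thesis
    by (auto simp: right_part_def)
qed

text \<open>A small set has some rank \<epsilon> < \<alpha>, and level 2\<alpha> includes the level
  2\<epsilon>+2 at which such sets are rigid.\<close>

lemma small_rigid:
  fixes X Y :: "real set"
  assumes rigid: "\<forall>\<epsilon><\<alpha>. short_rigid \<epsilon>" and Y: "small \<alpha> Y" and bf: "bf (odouble \<alpha>) X Y"
  shows "similar X Y"
proof -
  obtain \<epsilon> where \<epsilon>: "\<epsilon> < \<alpha>" "rank_le \<epsilon> Y"
    using Y by (auto simp: small_def)
  have "osucc (osucc (odouble \<epsilon>)) \<le> odouble \<alpha>"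
    using osucc_odouble_less[OF \<epsilon>(1)] by (simp add: osucc_le_iff)
  then show ?thesis
    using rank_rigid[OF rigid[rule_format, OF \<epsilon>(1)] \<epsilon>(2)] bf_mono[OF bf] by blast
qed

text \<open>The tails of the two right parts are matched in both directions. To recover the parts,
  \<open>similar_of_same_tails\<close> needs a level at which all tails are small but the whole is
  not; finding it may require cutting both parts at matching points first.\<close>

lemma right_part_rigid:
  fixes X Y :: "real set"
  assumes rigid: "\<forall>\<epsilon><\<alpha>. short_rigid \<epsilon>"
    and bf: "bf (osucc (odouble \<alpha>)) X Y"
    and X: "short \<alpha> X" "\<not> small \<alpha> X" and Y: "\<not> small \<alpha> Y"
  shows "similar (right_part \<alpha> X) (right_part \<alpha> Y)"
proof -
  let ?M = "right_part \<alpha> X" and ?N = "right_part \<alpha> Y"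
  have pull: "small \<alpha> A" if "small \<alpha> B" "bf (odouble \<alpha>) A B" for A B :: "real set"
    using small_similar[OF similar_sym[OF small_rigid[OF rigid that]] that(1)] .
  have point: "\<exists>a\<in>?M. bf (odouble \<alpha>) (Y \<inter> {..<b}) (X \<inter> {..<a}) \<and> similar (Y \<inter> {b<..}) (X \<inter> {a<..})"
    if "b \<in> ?N" for b
  proof -
    have b: "b \<in> Y" "small \<alpha> (Y \<inter> {b<..})"
      using that by (auto simp: right_part_def)
    obtain a where a: "a \<in> X" "bf (odouble \<alpha>) (Y \<inter> {..<b}) (X \<inter> {..<a})"
      "bf (odouble \<alpha>) (Y \<inter> {b<..}) (X \<inter> {a<..})"
      using bf_point[OF bf less_osucc b(1)] by metis
    \<comment> \<open>Not small below \<open>b\<close> implies not small below \<open>a\<close>, as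
      smallness passes from right to left at level 2\<alpha>. Shortness of \<open>X\<close> then
      makes the other side of \<open>a\<close> small.\<close>
    have "\<not> small \<alpha> (Y \<inter> {..<b})"
      using small_split[OF _ b(2)] Y by blast
    then have "\<not> small \<alpha> (X \<inter> {..<a})"
      using pull[OF _ a(2)] by blast
    then have "small \<alpha> (X \<inter> {a<..})"
      using X(1) a(1) by (auto simp: short_def)
    then show ?thesis
      using a small_rigid[OF rigid _ a(3)] by (auto simp: right_part_def)
  qed
  have tailN: "\<exists>a\<in>?M. similar (?N \<inter> {b<..}) (?M \<inter> {a<..})" if "b \<in> ?N" for b
    using point[OF that] right_part_tail[OF that] right_part_tail[of _ \<alpha> X] by metis
  \<comment> \<open>For a point of \<open>X\<close> the sides must first be exchanged, which leaves
    level 2\<alpha>. That is enough for \<open>match_tail\<close>, since the tail has rank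
    \<epsilon> < \<alpha>.\<close>
  have tailM: "\<exists>b\<in>?N. similar (?N \<inter> {b<..}) (?M \<inter> {a<..})" if a: "a \<in> ?M" for a
  proof -
    have "a \<in> X" "small \<alpha> (X \<inter> {a<..})"
      using a by (simp_all add: right_part_def)
    then obtain \<epsilon> where \<epsilon>: "\<epsilon> < \<alpha>" "rank_le \<epsilon> (X \<inter> {a<..})"
      by (auto simp: small_def)
    from match_tail[OF rigid[rule_format, OF \<epsilon>(1)] bf_flip[OF bf less_osucc] osucc_odouble_less[OF \<epsilon>(1)] \<open>a \<in> X\<close> \<epsilon>(2)]
    obtain b where b: "b \<in> Y" "similar (X \<inter> {a<..}) (Y \<inter> {b<..})" .
    have "small \<alpha> (Y \<inter> {b<..})"
      using small_similar[OF b(2) \<open>small \<alpha> (X \<inter> {a<..})\<close>] .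
    then have "b \<in> ?N"
      using b(1) by (simp add: right_part_def)
    then show ?thesis
      using similar_sym[OF b(2)] right_part_tail[OF a] right_part_tail[of b \<alpha> Y] by metis
  qed
  have tail_small: "small \<alpha> (?N \<inter> {b<..})" if "b \<in> ?N" for b
    using that right_part_tail[OF that] by (simp add: right_part_def)
  show ?thesis
  proof (cases "?N = {}")
    case True
    then have "?M = {}"
      using tailM by blast
    then show ?thesis
      using True by simp
  next
    case False
    \<comment> \<open>Such a \<open>b\<close> lies in the leftmost class of the condensation at
      level \<delta>. The least possible \<delta> measures the left end of the right part.\<close>
    define uniform where "uniform \<delta> b \<longleftrightarrow> b \<in> ?N \<and> (\<forall>x\<in>?N. x < b \<longrightarrow> small \<delta> (?N \<inter> {x<..<b}))" for \<delta> b
    have "uniform \<alpha> b" if "b \<in> ?N" for b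
      unfolding uniform_def using that by (auto intro: small_subset[OF tail_small])
    then have ex: "\<exists>b. uniform \<alpha> b"
      using False by blast
    define \<delta> where "\<delta> = (LEAST \<delta>. \<exists>b. uniform \<delta> b)"
    have "\<exists>b. uniform \<delta> b"
      unfolding \<delta>_def using ex by (rule LeastI)
    then obtain b where b: "uniform \<delta> b"
      by blast
    have least: "\<not> uniform \<epsilon> x" if "\<epsilon> < \<delta>" for \<epsilon> x
      using not_less_Least[of \<epsilon>] that unfolding \<delta>_def by blast
    have "\<delta> \<le> \<alpha>"
      unfolding \<delta>_def using ex by (rule Least_le)
    show ?thesis
    proof (cases "\<delta> = \<alpha>")
      case True
      \<comment> \<open>A rank \<epsilon> < \<alpha> would mean finitely many classes at level
        \<epsilon>, hence a leftmost one, contradicting the minimality of \<delta>.\<close>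
      have "\<not> small \<alpha> ?N"
      proof
        assume "small \<alpha> ?N"
        then obtain \<epsilon> n where \<epsilon>: "\<epsilon> < \<alpha>" "classes_le \<epsilon> n ?N"
          by (auto simp: small_def rank_le_iff)
        from leftmost_class[OF \<epsilon>(2) False] obtain x where
          "x \<in> ?N" "\<And>z. z \<in> ?N \<Longrightarrow> z < x \<Longrightarrow> small \<epsilon> (?N \<inter> {z<..<x})"
          by metis
        then have "uniform \<epsilon> x"
          by (simp add: uniform_def)
        then show False
          using least \<epsilon>(1) True by blast
      qed
      from similar_of_same_tails[OF tailN tailM tail_small this] show ?thesis
        by (rule similar_sym) auto
    next
      case False
      then have \<delta>: "\<delta> < \<alpha>"
        using \<open>\<delta> \<le> \<alpha>\<close> by simp
      have bN: "b \<in> ?N" "b \<in> Y"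
        using b by (auto simp: uniform_def right_part_def)
      obtain a where a: "a \<in> ?M" "bf (odouble \<alpha>) (Y \<inter> {..<b}) (X \<inter> {..<a})"
        "similar (Y \<inter> {b<..}) (X \<inter> {a<..})"
        using point[OF bN(1)] by blast
      have aX: "a \<in> X"
        using a(1) by (simp add: right_part_def)
      let ?E = "?N \<inter> {..<b}" and ?D = "?M \<inter> {..<a}"
      have E_tail: "?E \<inter> {x<..} = Y \<inter> {..<b} \<inter> {x<..}" if "x \<in> ?E" for x
        using right_part_tail[of x \<alpha> Y] that by auto
      have D_tail: "?D \<inter> {x<..} = X \<inter> {..<a} \<inter> {x<..}" if "x \<in> ?D" for x
        using right_part_tail[of x \<alpha> X] that by auto
      \<comment> \<open>The tail above \<open>b\<close> is small, so a point below \<open>b\<close>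
        belongs to the right part as soon as its segment up to \<open>b\<close> is small.\<close>
      have memN: "y \<in> ?E" if "y \<in> Y \<inter> {..<b}" "small \<alpha> (Y \<inter> {..<b} \<inter> {y<..})" for y
      proof -
        have "Y \<inter> {y<..} \<inter> {..<b} = Y \<inter> {..<b} \<inter> {y<..}" "Y \<inter> {y<..} \<inter> {b<..} = Y \<inter> {b<..}"
          using that(1) by auto
        then have "small \<alpha> (Y \<inter> {y<..})"
          using small_split[of \<alpha> "Y \<inter> {y<..}" b] that(2) bN by (simp add: right_part_def)
        then show ?thesis
          using that(1) by (simp add: right_part_def)
      qed
      have memM: "x \<in> ?D" if "x \<in> X \<inter> {..<a}" "small \<alpha> (X \<inter> {..<a} \<inter> {x<..})" for x
      proof -
        have "X \<inter> {x<..} \<inter> {..<a} = X \<inter> {..<a} \<inter> {x<..}" "X \<inter> {x<..} \<inter> {a<..} = X \<inter> {a<..}"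
          using that(1) by auto
        then have "small \<alpha> (X \<inter> {x<..})"
          using small_split[of \<alpha> "X \<inter> {x<..}" a] that(2) a(1) by (simp add: right_part_def)
        then show ?thesis
          using that(1) by (simp add: right_part_def)
      qed
      have E_small: "small \<delta> (?E \<inter> {x<..})" if "x \<in> ?E" for x
      proof -
        have "?E \<inter> {x<..} = ?N \<inter> {x<..<b}"
          by auto
        then show ?thesis
          using b that by (simp add: uniform_def)
      qed
      have "similar ?E ?D"
      proof (rule similar_of_same_tails[OF _ _ E_small])
        fix x assume x: "x \<in> ?E"
        obtain \<epsilon> where \<epsilon>: "\<epsilon> < \<delta>" "rank_le \<epsilon> (Y \<inter> {..<b} \<inter> {x<..})"
          using E_small[OF x] E_tail[OF x] by (auto simp: small_def)
        have "\<epsilon> < \<alpha>"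
          using \<epsilon>(1) \<delta> by simp
        \<comment> \<open>Exchanging sides lowers the level, but 2\<delta>+1 is still available. It
          exceeds 2\<epsilon>+1 because tails of \<open>?E\<close> have rank \<epsilon> < \<delta>.
          For \<open>?D\<close>, whose tails are only known to be small at \<alpha>, the relation at
          level 2\<alpha> is used without exchange.\<close>
        have flip: "bf (osucc (odouble \<delta>)) (X \<inter> {..<a}) (Y \<inter> {..<b})"
          using bf_flip[OF a(2) osucc_odouble_less[OF \<delta>]] .
        have "osucc (odouble \<epsilon>) < osucc (odouble \<delta>)"
          using osucc_odouble_less[OF \<epsilon>(1)] less_osucc[of "odouble \<delta>"] by simp
        moreover have "x \<in> Y \<inter> {..<b}"
          using x by (simp add: right_part_def)
        ultimately obtain y where y: "y \<in> X \<inter> {..<a}"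
          "similar (Y \<inter> {..<b} \<inter> {x<..}) (X \<inter> {..<a} \<inter> {y<..})"
          using match_tail[OF rigid[rule_format, OF \<open>\<epsilon> < \<alpha>\<close>] flip _ _ \<epsilon>(2)] by metis
        have "small \<alpha> (X \<inter> {..<a} \<inter> {y<..})"
          using rank_le_similar[OF y(2) \<epsilon>(2)] \<open>\<epsilon> < \<alpha>\<close> by (auto simp: small_def)
        then have "y \<in> ?D"
          using memM y(1) by blast
        then show "\<exists>y\<in>?D. similar (?E \<inter> {x<..}) (?D \<inter> {y<..})"
          using y(2) E_tail[OF x] D_tail by metis
      next
        fix x assume x: "x \<in> ?D"
        then have "small \<alpha> (X \<inter> {x<..})"
          by (simp add: right_part_def)
        then have "small \<alpha> (X \<inter> {..<a} \<inter> {x<..})"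
          by (rule small_subset) auto
        then obtain \<epsilon> where \<epsilon>: "\<epsilon> < \<alpha>" "rank_le \<epsilon> (X \<inter> {..<a} \<inter> {x<..})"
          by (auto simp: small_def)
        have "x \<in> X \<inter> {..<a}"
          using x by (simp add: right_part_def)
        then obtain y where y: "y \<in> Y \<inter> {..<b}"
          "similar (X \<inter> {..<a} \<inter> {x<..}) (Y \<inter> {..<b} \<inter> {y<..})"
          using match_tail[OF rigid[rule_format, OF \<epsilon>(1)] a(2) osucc_odouble_less[OF \<epsilon>(1)] _ \<epsilon>(2)] by metis
        have "small \<alpha> (Y \<inter> {..<b} \<inter> {y<..})"
          using rank_le_similar[OF y(2) \<epsilon>(2)] \<epsilon>(1) by (auto simp: small_def)
        then have "y \<in> ?E"
          using memN y(1) by blast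
        then show "\<exists>y\<in>?E. similar (?E \<inter> {y<..}) (?D \<inter> {x<..})"
          using similar_sym[OF y(2)] E_tail D_tail[OF x] by metis
      next
        \<comment> \<open>A leftmost class of \<open>?E\<close> at a level \<epsilon> < \<delta>
          would also be leftmost in \<open>?N\<close>, against minimality; if \<open>?E\<close> is
          empty, then \<open>b\<close> is the first point of \<open>?N\<close> and is uniform at
          every level.\<close>
        show "\<not> small \<delta> ?E"
        proof
          assume "small \<delta> ?E"
          then obtain \<epsilon> n where \<epsilon>: "\<epsilon> < \<delta>" "classes_le \<epsilon> n ?E"
            by (auto simp: small_def rank_le_iff)
          show False
          proof (cases "?E = {}")
            case True
            then have "uniform \<epsilon> b"
              using bN by (auto simp: uniform_def)
            then show False
              using least \<epsilon>(1) by blast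
          next
            case False
            from leftmost_class[OF \<epsilon>(2) False] obtain x where
              x: "x \<in> ?E" "\<And>z. z \<in> ?E \<Longrightarrow> z < x \<Longrightarrow> small \<epsilon> (?E \<inter> {z<..<x})"
              by metis
            have "?E \<inter> {z<..<x} = ?N \<inter> {z<..<x}" for z
              using x(1) by auto
            then have "uniform \<epsilon> x"
              using x by (auto simp: uniform_def)
            then show False
              using least \<epsilon>(1) by blast
          qed
        qed
      qed
      moreover have "similar (?N \<inter> {b<..}) (?M \<inter> {a<..})"
        using a(3) right_part_tail[OF bN(1)] right_part_tail[OF a(1)] by simp
      ultimately have "similar ?N ?M"
        using similar_split[OF bN(1) a(1)] by blast
      then show ?thesis
        by (rule similar_sym)
    qed
  qed
qed

lemma all_short_rigid: "short_rigid \<alpha>"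
proof (induction \<alpha> rule: less_induct)
  case (less \<alpha>)
  then have IH: "\<forall>\<epsilon><\<alpha>. short_rigid \<epsilon>"
    by blast
  show ?case
    unfolding short_rigid_def
  proof (intro allI impI)
    fix X Y :: "real set"
    assume X: "short \<alpha> X" and bf: "bf (osucc (odouble \<alpha>)) X Y"
    have pull: "small \<alpha> A" if "small \<alpha> B" "bf (odouble \<alpha>) A B" for A B :: "real set"
      using small_similar[OF similar_sym[OF small_rigid[OF IH that]] that(1)] .
    have mono: "bf (odouble \<alpha>) X Y"
      by (rule bf_mono[OF bf]) (simp add: less_osucc less_imp_le)
    show "similar X Y"
    proof (cases "small \<alpha> X \<or> small \<alpha> Y")
      case True
      then show ?thesis
        using small_rigid[OF IH _ mono] similar_sym[OF small_rigid[OF IH _ bf_flip[OF bf less_osucc]]]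
        by blast
    next
      case False
      \<comment> \<open>The points with a small initial segment, obtained by reflecting, taking the
        right part and reflecting back.\<close>
      let ?l = "\<lambda>X. uminus ` right_part \<alpha> (uminus ` X) :: real set"
      have left: "?l Z = {x \<in> Z. small \<alpha> (Z \<inter> {..<x})}" for Z
      proof -
        have "uminus ` Z \<inter> {- x<..} = uminus ` (Z \<inter> {..<x})" for x
          by (force simp: image_iff)
        then show ?thesis
          by (force simp: right_part_def small_uminus image_iff)
      qed
      have "short \<alpha> (uminus ` X)"
        unfolding short_def
      proof
        fix y assume "y \<in> uminus ` X"
        then obtain x where x: "x \<in> X" "y = - x"
          by auto
        have "uminus ` X \<inter> {- x<..} = uminus ` (X \<inter> {..<x})" "uminus ` X \<inter> {..<- x} = uminus ` (X \<inter> {x<..})"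
          by (force simp: image_iff)+
        then show "small \<alpha> (uminus ` X \<inter> {..<y}) \<or> small \<alpha> (uminus ` X \<inter> {y<..})"
          using X x by (auto simp: short_def small_uminus)
      qed
      then have "similar (right_part \<alpha> (uminus ` X)) (right_part \<alpha> (uminus ` Y))"
        using right_part_rigid[OF IH bf_uminus[OF bf]] False by (simp add: small_uminus)
      then have "similar (?l X) (?l Y)"
        by (rule similar_uminus[of "?l X" "?l Y", simplified image_image minus_minus image_ident])
      moreover have "similar (right_part \<alpha> X) (right_part \<alpha> Y)"
        using right_part_rigid[OF IH bf X] False by blast
      \<comment> \<open>If \<open>b\<close> were at most \<open>a\<close>, both sides of
        \<open>b\<close> would be small and hence \<open>Z\<close> as well.\<close>
      moreover have cut: "a < b" if "\<not> small \<alpha> Z" "a \<in> ?l Z" "b \<in> right_part \<alpha> Z" for Z a b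
      proof (rule ccontr)
        assume "\<not> a < b"
        then have "small \<alpha> (Z \<inter> {..<b})"
          using that(2) unfolding left by (auto elim!: small_subset)
        then show False
          using small_split that(1,3) by (auto simp: right_part_def)
      qed
      ultimately have "similar (?l X \<union> right_part \<alpha> X) (?l Y \<union> right_part \<alpha> Y)"
        by (intro similar_Un) (use False in blast)+
      moreover have "?l X \<union> right_part \<alpha> X = X"
        using X unfolding left by (auto simp: short_def right_part_def)
      moreover have "?l Y \<union> right_part \<alpha> Y = Y"
      proof -
        \<comment> \<open>Shortness transfers to \<open>Y\<close>: one of the two segments at the
          answer \<open>a\<close> is small, and smallness passes back to the corresponding segment
          at \<open>b\<close>.\<close>
        have "small \<alpha> (Y \<inter> {..<b}) \<or> small \<alpha> (Y \<inter> {b<..})" if b: "b \<in> Y" for b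
        proof -
          obtain a where a: "a \<in> X" "bf (odouble \<alpha>) (Y \<inter> {..<b}) (X \<inter> {..<a})"
            "bf (odouble \<alpha>) (Y \<inter> {b<..}) (X \<inter> {a<..})"
            using bf_point[OF bf less_osucc b] by metis
          then show ?thesis
            using X pull[OF _ a(2)] pull[OF _ a(3)] unfolding short_def by blast
        qed
        then show ?thesis
          unfolding left by (auto simp: right_part_def)
      qed
      ultimately show ?thesis
        by simp
    qed
  qed
qed

section \<open>From formulas to the game\<close>

definition set_order :: "'a::linorder set \<Rightarrow> 'a rel" where
  "set_order X = {(x, y). x \<in> X \<and> y \<in> X \<and> x \<le> y}"

lemma Field_set_order [simp]: "Field (set_order X) = X"
  by (auto simp: set_order_def Field_def)

lemma rcset_acset: "countable A \<Longrightarrow> rcset (acset A) = A"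
  by (simp add: acset_inverse)

lemma rcset_cimage [simp]: "rcset (cimage f A) = f ` rcset A"
  by (rule cimage.rep_eq)

lemma sat_iso:
  assumes f: "inj_on f (Field L)" "f ` Field L = Field L'"
    "\<And>x y. x \<in> Field L \<Longrightarrow> y \<in> Field L \<Longrightarrow> (x, y) \<in> L \<longleftrightarrow> (f x, f y) \<in> L'"
    and s: "\<And>i. i \<in> free_vars \<phi> \<Longrightarrow> s i \<in> Field L \<and> t i = f (s i)"
  shows "sat L \<phi> s \<longleftrightarrow> sat L' \<phi> t"
  using s
proof (induction \<phi> arbitrary: s t)
  case (Leq x y)
  then show ?case using f(3) by simp
next
  case (Eq x y)
  then show ?case using inj_on_eq_iff[OF f(1)] by simp
next
  case (Neg \<phi>)
  have "sat L \<phi> s \<longleftrightarrow> sat L' \<phi> t"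
    by (rule Neg.IH) (use Neg.prems in auto)
  then show ?case by simp
next
  case (Conj \<Phi>)
  have "sat L \<phi> s \<longleftrightarrow> sat L' \<phi> t" if "\<phi> \<in> rcset \<Phi>" for \<phi>
    by (rule Conj.IH[OF that]) (use Conj.prems that in auto)
  then show ?case by simp
next
  case (Disj \<Phi>)
  have "sat L \<phi> s \<longleftrightarrow> sat L' \<phi> t" if "\<phi> \<in> rcset \<Phi>" for \<phi>
    by (rule Disj.IH[OF that]) (use Disj.prems that in auto)
  then show ?case by simp
next
  case (Ex x \<phi>)
  have "sat L \<phi> (s(x := a)) \<longleftrightarrow> sat L' \<phi> (t(x := f a))" if "a \<in> Field L" for a
    by (rule Ex.IH) (use Ex.prems that in auto)
  then show ?case by (simp flip: f(2))
next
  case (All x \<phi>)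
  have "sat L \<phi> (s(x := a)) \<longleftrightarrow> sat L' \<phi> (t(x := f a))" if "a \<in> Field L" for a
    by (rule All.IH) (use All.prems that in auto)
  then show ?case by (simp flip: f(2))
qed

text \<open>Negation is expressed semantically because \<open>Neg\<close> does not in general turn a
  \<open>Sigma_fm\<close> into a \<open>Pi_fm\<close>. Relations on the reals suffice, as all
  formulas are compared there.\<close>

definition negates :: "fm \<Rightarrow> fm \<Rightarrow> bool" where
  "negates \<psi> \<phi> \<longleftrightarrow> free_vars \<psi> = free_vars \<phi> \<and> (\<forall>(L :: real rel) s. sat L \<psi> s \<longleftrightarrow> \<not> sat L \<phi> s)"

lemma negates_foldr:
  assumes "negates \<psi> \<phi>"
  shows "negates (foldr All xs \<psi>) (foldr Ex xs \<phi>)" "negates (foldr Ex xs \<psi>) (foldr All xs \<phi>)"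
  using assms by (induction xs) (auto simp: negates_def)

lemma negates_cset:
  assumes "\<And>\<phi>. \<phi> \<in> rcset \<Phi> \<Longrightarrow> negates (d \<phi>) \<phi>"
  shows "negates (Conj (cimage d \<Phi>)) (Disj \<Phi>)" "negates (Disj (cimage d \<Phi>)) (Conj \<Phi>)"
  using assms by (auto simp: negates_def)

text \<open>De Morgan duality, by simultaneous induction; only at level 0 is the connective
  \<open>Neg\<close> itself used.\<close>

lemma Sigma_Pi_negation:
  shows "Sigma_fm \<beta> \<phi> \<Longrightarrow> \<exists>\<psi>. Pi_fm \<beta> \<psi> \<and> negates \<psi> \<phi>"
    and "Pi_fm \<beta> \<phi> \<Longrightarrow> \<exists>\<psi>. Sigma_fm \<beta> \<psi> \<and> negates \<psi> \<phi>"
proof (induction rule: Sigma_fm_Pi_fm.inducts)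
  case (1 \<phi>)
  then show ?case
    by (intro exI[of _ "Neg \<phi>"]) (auto simp: negates_def intro: finitary_qf.intros Sigma_fm_Pi_fm.intros)
next
  case (2 \<phi>)
  then show ?case
    by (intro exI[of _ "Neg \<phi>"]) (auto simp: negates_def intro: finitary_qf.intros Sigma_fm_Pi_fm.intros)
next
  case (3 \<beta> \<Phi>)
  have "\<exists>\<chi>. negates \<chi> \<psi> \<and> (\<exists>xs \<phi> \<gamma>. \<chi> = foldr All xs \<phi> \<and> \<gamma> < \<beta> \<and> Sigma_fm \<gamma> \<phi>)"
    if "\<psi> \<in> rcset \<Phi>" for \<psi>
  proof -
    obtain xs \<phi> \<gamma> \<phi>' where "\<psi> = foldr Ex xs \<phi>" "\<gamma> < \<beta>" "Sigma_fm \<gamma> \<phi>'" "negates \<phi>' \<phi>"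
      using 3(2)[OF \<open>\<psi> \<in> rcset \<Phi>\<close>] by blast
    then show ?thesis
      using negates_foldr(1)[of \<phi>' \<phi> xs] by blast
  qed
  then obtain d where d: "\<And>\<psi>. \<psi> \<in> rcset \<Phi> \<Longrightarrow> negates (d \<psi>) \<psi>"
    "\<And>\<psi>. \<psi> \<in> rcset \<Phi> \<Longrightarrow> \<exists>xs \<phi> \<gamma>. d \<psi> = foldr All xs \<phi> \<and> \<gamma> < \<beta> \<and> Sigma_fm \<gamma> \<phi>"
    by metis
  have "Pi_fm \<beta> (Conj (cimage d \<Phi>))"
    by (rule Sigma_fm_Pi_fm.intros(4)[OF 3(1)]) (use d(2) in auto)
  then show ?case
    using negates_cset(1)[OF d(1)] by blast
next
  case (4 \<beta> \<Phi>)
  have "\<exists>\<chi>. negates \<chi> \<psi> \<and> (\<exists>xs \<phi> \<gamma>. \<chi> = foldr Ex xs \<phi> \<and> \<gamma> < \<beta> \<and> Pi_fm \<gamma> \<phi>)"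
    if "\<psi> \<in> rcset \<Phi>" for \<psi>
  proof -
    obtain xs \<phi> \<gamma> \<phi>' where "\<psi> = foldr All xs \<phi>" "\<gamma> < \<beta>" "Pi_fm \<gamma> \<phi>'" "negates \<phi>' \<phi>"
      using 4(2)[OF \<open>\<psi> \<in> rcset \<Phi>\<close>] by blast
    then show ?thesis
      using negates_foldr(2)[of \<phi>' \<phi> xs] by blast
  qed
  then obtain d where d: "\<And>\<psi>. \<psi> \<in> rcset \<Phi> \<Longrightarrow> negates (d \<psi>) \<psi>"
    "\<And>\<psi>. \<psi> \<in> rcset \<Phi> \<Longrightarrow> \<exists>xs \<phi> \<gamma>. d \<psi> = foldr Ex xs \<phi> \<and> \<gamma> < \<beta> \<and> Pi_fm \<gamma> \<phi>"
    by metis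
  have "Sigma_fm \<beta> (Disj (cimage d \<Phi>))"
    by (rule Sigma_fm_Pi_fm.intros(3)[OF 4(1)]) (use d(2) in auto)
  then show ?case
    using negates_cset(2)[OF d(1)] by blast
qed

lemma free_vars_foldr_All: "free_vars (foldr All xs \<phi>) = free_vars \<phi> - set xs"
  by (induction xs) auto

lemma sat_foldr_All:
  "sat L (foldr All xs \<phi>) s \<longleftrightarrow>
     (\<forall>t. (\<forall>i\<in>set xs. t i \<in> Field L) \<longrightarrow> (\<forall>i. i \<notin> set xs \<longrightarrow> t i = s i) \<longrightarrow> sat L \<phi> t)"
proof (induction xs arbitrary: s)
  case Nil
  have "t = s" if "\<forall>i. t i = s i" for t :: "nat \<Rightarrow> 'a"
    using that by blast
  then show ?case
    by auto
next
  case (Cons x xs)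
  show ?case
  proof
    assume *: "sat L (foldr All (x # xs) \<phi>) s"
    show "\<forall>t. (\<forall>i\<in>set (x # xs). t i \<in> Field L) \<longrightarrow> (\<forall>i. i \<notin> set (x # xs) \<longrightarrow> t i = s i) \<longrightarrow> sat L \<phi> t"
    proof (intro allI impI)
      fix t assume t: "\<forall>i\<in>set (x # xs). t i \<in> Field L" "\<forall>i. i \<notin> set (x # xs) \<longrightarrow> t i = s i"
      then have "sat L (foldr All xs \<phi>) (s(x := t x))"
        using * by simp
      then show "sat L \<phi> t"
        unfolding Cons.IH using t by auto
    qed
  next
    assume *: "\<forall>t. (\<forall>i\<in>set (x # xs). t i \<in> Field L) \<longrightarrow> (\<forall>i. i \<notin> set (x # xs) \<longrightarrow> t i = s i) \<longrightarrow> sat L \<phi> t"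
    have "sat L (foldr All xs \<phi>) (s(x := a))" if "a \<in> Field L" for a
      unfolding Cons.IH
    proof (intro allI impI)
      fix t assume t: "\<forall>i\<in>set xs. t i \<in> Field L" "\<forall>i. i \<notin> set xs \<longrightarrow> t i = (s(x := a)) i"
      \<comment> \<open>The variable \<open>x\<close> may occur again in \<open>xs\<close>, and then
        an inner quantifier overrides the value \<open>a\<close>.\<close>
      have "t x \<in> Field L"
        using t \<open>a \<in> Field L\<close> by (cases "x \<in> set xs") auto
      then show "sat L \<phi> t"
        using * t by auto
    qed
    then show "sat L (foldr All (x # xs) \<phi>) s"
      by simp
  qed
qed

text \<open>At a positive level every formula is itself a disjunction of existential formulas;
  taking the union of all their disjuncts avoids raising the level.\<close>

lemma Sigma_fm_Disj:
  assumes "0 < \<gamma>" "countable \<Psi>" "\<And>\<psi>. \<psi> \<in> \<Psi> \<Longrightarrow> Sigma_fm \<gamma> \<psi>"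
  obtains \<theta> where "Sigma_fm \<gamma> \<theta>" "free_vars \<theta> = (\<Union>\<psi>\<in>\<Psi>. free_vars \<psi>)"
    "\<And>(L :: real rel) s. sat L \<theta> s \<longleftrightarrow> (\<exists>\<psi>\<in>\<Psi>. sat L \<psi> s)"
proof -
  have "\<exists>\<Phi>. \<psi> = Disj \<Phi> \<and> (\<forall>\<chi>\<in>rcset \<Phi>. \<exists>xs \<phi> \<delta>. \<chi> = foldr Ex xs \<phi> \<and> \<delta> < \<gamma> \<and> Pi_fm \<delta> \<phi>)"
    if "\<psi> \<in> \<Psi>" for \<psi>
    using assms(3)[OF that] assms(1) by (cases rule: Sigma_fm.cases) auto
  then obtain d where d: "\<And>\<psi>. \<psi> \<in> \<Psi> \<Longrightarrow> \<psi> = Disj (d \<psi>)"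
    "\<And>\<psi> \<chi>. \<psi> \<in> \<Psi> \<Longrightarrow> \<chi> \<in> rcset (d \<psi>) \<Longrightarrow> \<exists>xs \<phi> \<delta>. \<chi> = foldr Ex xs \<phi> \<and> \<delta> < \<gamma> \<and> Pi_fm \<delta> \<phi>"
    by metis
  define \<Theta> where "\<Theta> = acset (\<Union>\<psi>\<in>\<Psi>. rcset (d \<psi>))"
  have \<Theta>: "rcset \<Theta> = (\<Union>\<psi>\<in>\<Psi>. rcset (d \<psi>))"
    unfolding \<Theta>_def using assms(2) rcset by (intro rcset_acset countable_UN) auto
  have sat: "sat L \<psi> s \<longleftrightarrow> (\<exists>\<chi>\<in>rcset (d \<psi>). sat L \<chi> s)" if "\<psi> \<in> \<Psi>" for \<psi> s and L :: "real rel"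
    by (subst d(1)[OF that]) simp
  have fv: "free_vars \<psi> = (\<Union>\<chi>\<in>rcset (d \<psi>). free_vars \<chi>)" if "\<psi> \<in> \<Psi>" for \<psi>
    by (subst d(1)[OF that]) simp
  show ?thesis
  proof (rule that[of "Disj \<Theta>"])
    show "Sigma_fm \<gamma> (Disj \<Theta>)"
      by (rule Sigma_fm_Pi_fm.intros(3)[OF assms(1)]) (use d(2) \<Theta> in auto)
    show "free_vars (Disj \<Theta>) = (\<Union>\<psi>\<in>\<Psi>. free_vars \<psi>)"
      using fv by (simp add: \<Theta>)
    show "sat L (Disj \<Theta>) s \<longleftrightarrow> (\<exists>\<psi>\<in>\<Psi>. sat L \<psi> s)" for L :: "real rel" and s
      using sat[of _ L s] by (simp add: \<Theta>)
  qed
qed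

lemma bf_0: "bf 0 X Y"
proof -
  have "{..<0 :: cord} = {}"
    using zero_le_cord by (auto simp: not_less[symmetric] simp del: zero_le_cord)
  then show ?thesis
    unfolding bf.simps[of 0] by simp
qed

text \<open>A move \<open>F\<close> in \<open>Y\<close> without a good answer gives a formula: every
  tuple is either misplaced or satisfies one of countably many \<Sigma> formulas, each of which
  refutes one answer. The end points of the pieces stay as free variables, so quantifiers range over
  the whole of \<open>X\<close> and \<open>Y\<close> and need no relativization.\<close>

lemma formula_of_not_bf:
  fixes X Y :: "real set"
  assumes "countable X" "countable Y" "finite I" "finite J"
    "s ` (I \<union> J) \<subseteq> X" "t ` (I \<union> J) \<subseteq> Y"
    "\<not> bf \<beta> (between (s ` I) (s ` J) X) (between (t ` I) (t ` J) Y)"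
  shows "\<exists>\<phi>. Pi_fm \<beta> \<phi> \<and> free_vars \<phi> \<subseteq> I \<union> J \<and> sat (set_order X) \<phi> s \<and> \<not> sat (set_order Y) \<phi> t"
  using assms
proof (induction \<beta> arbitrary: X Y I J s t rule: less_induct)
  case (less \<beta>)
  let ?A = "between (s ` I) (s ` J) X" and ?B = "between (t ` I) (t ` J) Y"
  obtain \<gamma> F where \<gamma>: "\<gamma> < \<beta>" and F: "finite F" "F \<subseteq> ?B"
    and fail: "\<And>f. strict_mono_on F f \<Longrightarrow> f ` F \<subseteq> ?A \<Longrightarrow>
      \<exists>G\<subseteq>F. \<not> bf \<gamma> (between G (F - G) ?B) (between (f ` G) (f ` (F - G)) ?A)"
    using less.prems(7) unfolding bf.simps[of \<beta>] by auto
  obtain n where n: "I \<union> J \<subseteq> {..<n}"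
    using less.prems(3,4) finite_nat_iff_bounded[of "I \<union> J"] by auto
  obtain h where h: "bij_betw h F {0..<card F}"
    using ex_bij_betw_finite_nat[OF F(1)] by blast
  define e where "e x = n + h x" for x
  have inj: "inj_on e F"
    using h by (auto simp: e_def bij_betw_def inj_on_def)
  have fresh: "e x \<notin> I \<union> J" for x
    using n by (auto simp: e_def)
  define vs where "vs = sorted_list_of_set (e ` F)"
  have vs: "set vs = e ` F"
    using F(1) by (simp add: vs_def)
  \<comment> \<open>The fresh variables name the points of the move \<open>F\<close>; the others
    keep their values under \<open>t\<close>.\<close>
  define t' where "t' i = (if i \<in> e ` F then inv_into F e i else t i)" for i
  have t'e: "t' (e x) = x" if "x \<in> F" for x
    using that inj by (simp add: t'_def)
  have t'IJ: "t' i = t i" if "i \<in> I \<union> J" for i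
    using that fresh by (auto simp: t'_def)
  \<comment> \<open>The strict inequalities between variables saying that a tuple lies in the piece
    and is ordered like \<open>F\<close>. In a linear order the failure of one of them is an atomic
    formula, which makes \<chi> quantifier-free.\<close>
  define E where "E = I \<times> e ` F \<union> e ` F \<times> J \<union> (\<lambda>(x, y). (e x, e y)) ` {(x, y). x \<in> F \<and> y \<in> F \<and> x < y}"
  have "finite {(x, y). x \<in> F \<and> y \<in> F \<and> x < y}"
    by (rule finite_subset[of _ "F \<times> F"]) (use F(1) in auto)
  then have finE: "finite E"
    unfolding E_def using less.prems(3,4) F(1) by auto
  have Edom: "E \<subseteq> (I \<union> J \<union> e ` F) \<times> (I \<union> J \<union> e ` F)"
    by (auto simp: E_def)
  define \<chi> where "\<chi> = Disj (acset ((\<lambda>(a, b). Leq b a) ` E))"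
  have cE: "rcset (acset ((\<lambda>(a, b). Leq b a) ` E)) = (\<lambda>(a, b). Leq b a) ` E"
    using finE by (intro rcset_acset countable_finite) auto
  have \<chi>_qf: "finitary_qf \<chi>"
    unfolding \<chi>_def by (rule finitary_qf.intros(5)) (use finE in \<open>auto simp: cE intro: finitary_qf.intros\<close>)
  have \<chi>_fv: "free_vars \<chi> \<subseteq> I \<union> J \<union> e ` F"
    using Edom by (auto simp: \<chi>_def cE)
  have \<chi>_sat: "sat (set_order Z) \<chi> u \<longleftrightarrow> \<not> (\<forall>(a, b)\<in>E. u a < u b)" if "u ` (I \<union> J \<union> e ` F) \<subseteq> Z" for Z :: "real set" and u
  proof -
    have "(u b, u a) \<in> set_order Z \<longleftrightarrow> \<not> u a < u b" if "(a, b) \<in> E" for a b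
      using that Edom \<open>u ` (I \<union> J \<union> e ` F) \<subseteq> Z\<close> by (auto simp: set_order_def)
    then show ?thesis
      by (force simp: \<chi>_def cE)
  qed
  \<comment> \<open>The correctly placed answers. Each differs from \<open>s\<close> only at the
    finitely many fresh variables, so countability of \<open>X\<close> makes the disjunction over
    all answers countable.\<close>
  define U where "U = {u. (\<forall>i\<in>e ` F. u i \<in> X) \<and> (\<forall>i. i \<notin> e ` F \<longrightarrow> u i = s i) \<and> (\<forall>(a, b)\<in>E. u a < u b)}"
  have "countable ((\<lambda>u. map u vs) ` U)"
    by (rule countable_subset[OF _ countable_lists[OF less.prems(1)]]) (auto simp: U_def vs)
  moreover have "inj_on (\<lambda>u. map u vs) U"
  proof (rule inj_onI, rule ext)
    fix u u' i assume "u \<in> U" "u' \<in> U" "map u vs = map u' vs"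
    then show "u i = u' i"
      by (cases "i \<in> e ` F") (auto simp: U_def vs)
  qed
  ultimately have cU: "countable U"
    by (rule countable_image_inj_on)
  have "\<exists>\<psi>. Sigma_fm \<gamma> \<psi> \<and> free_vars \<psi> \<subseteq> I \<union> J \<union> e ` F \<and> sat (set_order X) \<psi> u \<and>
      \<not> sat (set_order Y) \<psi> t' \<and> 0 < \<gamma>" if u: "u \<in> U" for u
  proof -
    have uIJ: "u i = s i" if "i \<in> I \<union> J" for i
    proof -
      have "i \<notin> e ` F"
        using that fresh by blast
      then show ?thesis
        using u by (simp add: U_def)
    qed
    have uE: "u a < u b" if "(a, b) \<in> E" for a b
      using u that by (auto simp: U_def)
    define f where "f x = u (e x)" for x
    have mono: "strict_mono_on F f"
      by (rule strict_mono_onI) (auto simp: f_def E_def intro!: uE)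
    have "f x \<in> ?A" if "x \<in> F" for x
    proof -
      have "u i < f x" if "i \<in> I" for i
        using uE[of i "e x"] that \<open>x \<in> F\<close> by (auto simp: f_def E_def)
      moreover have "f x < u j" if "j \<in> J" for j
        using uE[of "e x" j] that \<open>x \<in> F\<close> by (auto simp: f_def E_def)
      moreover have "f x \<in> X"
        using u that by (auto simp: U_def f_def)
      ultimately show ?thesis
        using uIJ by (auto simp: between_def)
    qed
    then have "f ` F \<subseteq> ?A"
      by auto
    from fail[OF mono this] obtain G where G: "G \<subseteq> F"
      "\<not> bf \<gamma> (between G (F - G) ?B) (between (f ` G) (f ` (F - G)) ?A)"
      by blast
    have images: "t' ` I = t ` I" "t' ` J = t ` J" "u ` I = s ` I" "u ` J = s ` J"
      using t'IJ uIJ by auto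
    have eF: "t' ` e ` H = H" "u ` e ` H = f ` H" if "H \<subseteq> F" for H
      using that t'e by (auto simp: f_def image_image subset_iff)
    have "between (t' ` (I \<union> e ` G)) (t' ` (J \<union> e ` (F - G))) Y = between G (F - G) ?B"
      unfolding image_Un images using eF(1)[OF G(1)] eF(1)[of "F - G"] by (auto simp: between_def)
    moreover have "between (u ` (I \<union> e ` G)) (u ` (J \<union> e ` (F - G))) X = between (f ` G) (f ` (F - G)) ?A"
      unfolding image_Un images using eF(2)[OF G(1)] eF(2)[of "F - G"] by (auto simp: between_def)
    ultimately have nb: "\<not> bf \<gamma> (between (t' ` (I \<union> e ` G)) (t' ` (J \<union> e ` (F - G))) Y)
        (between (u ` (I \<union> e ` G)) (u ` (J \<union> e ` (F - G))) X)"
      using G(2) by simp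
    have FY: "F \<subseteq> Y"
      using F(2) by (auto simp: between_def)
    have fins: "finite (I \<union> e ` G)" "finite (J \<union> e ` (F - G))"
      using less.prems(3,4) F(1) G(1) by (auto intro: finite_subset)
    have "t' (e x) \<in> Y" "u (e x) \<in> X" if "x \<in> F" for x
      using that t'e FY u by (auto simp: U_def)
    then have eYX: "t' (e x) \<in> Y" "u (e x) \<in> X" if "x \<in> G \<or> x \<in> F - G" for x
      using that G(1) by blast+
    have tY: "t' ` (I \<union> e ` G \<union> (J \<union> e ` (F - G))) \<subseteq> Y"
      using less.prems(6) eYX(1) t'IJ by auto
    have uX: "u ` (I \<union> e ` G \<union> (J \<union> e ` (F - G))) \<subseteq> X"
      using less.prems(5) eYX(2) uIJ by auto
    \<comment> \<open>The induction hypothesis is applied with the sides exchanged, since a move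
      compares pieces of \<open>Y\<close> on the left with pieces of \<open>X\<close> on the right.
      The formula it gives is then negated.\<close>
    from less.IH[OF \<gamma> less.prems(2,1) fins tY uX nb] obtain \<phi> where
      \<phi>: "Pi_fm \<gamma> \<phi>" "free_vars \<phi> \<subseteq> I \<union> e ` G \<union> (J \<union> e ` (F - G))"
        "sat (set_order Y) \<phi> t'" "\<not> sat (set_order X) \<phi> u"
      by blast
    obtain \<psi> where "Sigma_fm \<gamma> \<psi>" "negates \<psi> \<phi>"
      using Sigma_Pi_negation(2)[OF \<phi>(1)] by blast
    \<comment> \<open>The relation at level 0 always holds, so a bad answer exists only at positive
      \<gamma>. At \<gamma> = 0 there are thus no correctly placed answers, and \<chi> alone is the
      required formula.\<close>
    moreover have "\<gamma> \<noteq> 0"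
      using nb bf_0 by blast
    then have "0 < \<gamma>"
      using zero_le_cord[of \<gamma>] by (simp add: order_le_less del: zero_le_cord)
    ultimately show ?thesis
      using \<phi> G(1) by (intro exI[of _ \<psi>]) (auto simp: negates_def)
  qed
  then obtain d where d: "\<And>u. u \<in> U \<Longrightarrow> Sigma_fm \<gamma> (d u)"
    "\<And>u. u \<in> U \<Longrightarrow> free_vars (d u) \<subseteq> I \<union> J \<union> e ` F" "\<And>u. u \<in> U \<Longrightarrow> sat (set_order X) (d u) u"
    "\<And>u. u \<in> U \<Longrightarrow> \<not> sat (set_order Y) (d u) t'" "\<And>u. u \<in> U \<Longrightarrow> 0 < \<gamma>"
    by metis
  obtain \<theta> where \<theta>: "Sigma_fm \<gamma> \<theta>" "free_vars \<theta> \<subseteq> I \<union> J \<union> e ` F"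
    "\<And>(L :: real rel) s. sat L \<theta> s \<longleftrightarrow> sat L \<chi> s \<or> (\<exists>u\<in>U. sat L (d u) s)"
  proof (cases "\<gamma> = 0")
    case True
    then have "U = {}"
      using d(5) by auto
    then show ?thesis
      using \<chi>_qf \<chi>_fv True by (intro that[of \<chi>]) (auto intro: Sigma_fm_Pi_fm.intros)
  next
    case False
    then have pos: "0 < \<gamma>"
      using zero_le_cord[of \<gamma>] by (simp add: order_le_less del: zero_le_cord)
    have single: "rcset (acset {\<chi>}) = {\<chi>}"
      by (rule rcset_acset) simp
    \<comment> \<open>The formula \<chi> has level 0 and must be wrapped in a disjunction with an
      empty quantifier block to be counted at level \<gamma>.\<close>
    have "Sigma_fm \<gamma> (Disj (acset {\<chi>}))"
    proof (rule Sigma_fm_Pi_fm.intros(3)[OF pos])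
      show "\<exists>xs \<phi> \<delta>. \<psi> = foldr Ex xs \<phi> \<and> \<delta> < \<gamma> \<and> Pi_fm \<delta> \<phi>" if "\<psi> \<in> rcset (acset {\<chi>})" for \<psi>
        using that pos \<chi>_qf single
        by (intro exI[of _ "[]"] exI[of _ \<chi>] exI[of _ 0]) (auto intro: Sigma_fm_Pi_fm.intros)
    qed
    then have sig: "Sigma_fm \<gamma> \<psi>" if "\<psi> \<in> insert (Disj (acset {\<chi>})) (d ` U)" for \<psi>
      using that d(1) by auto
    have "countable (insert (Disj (acset {\<chi>})) (d ` U))"
      using cU by auto
    from Sigma_fm_Disj[OF pos this sig] obtain \<theta> where
      "Sigma_fm \<gamma> \<theta>" "free_vars \<theta> = (\<Union>\<psi>\<in>insert (Disj (acset {\<chi>})) (d ` U). free_vars \<psi>)"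
      "\<And>(L :: real rel) s. sat L \<theta> s \<longleftrightarrow> (\<exists>\<psi>\<in>insert (Disj (acset {\<chi>})) (d ` U). sat L \<psi> s)"
      by metis
    moreover have "(\<Union>u\<in>U. free_vars (d u)) \<subseteq> I \<union> J \<union> e ` F"
      using d(2) by blast
    ultimately show ?thesis
      using \<chi>_fv single by (intro that[of \<theta>]) auto
  qed
  \<comment> \<open>A \<open>Pi_fm\<close> at a positive level has to be a conjunction, hence the
    one-element \<open>Conj\<close>.\<close>
  define \<phi> where "\<phi> = Conj (acset {foldr All vs \<theta>})"
  have single: "rcset (acset {foldr All vs \<theta>}) = {foldr All vs \<theta>}"
    by (rule rcset_acset) simp
  have \<phi>_sat: "sat L \<phi> r \<longleftrightarrow> sat L (foldr All vs \<theta>) r" for L :: "real rel" and r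
    by (simp add: \<phi>_def single)
  have "0 < \<beta>"
    using \<gamma> zero_le_cord[of \<gamma>] order.strict_trans1 by blast
  then have "Pi_fm \<beta> \<phi>"
    unfolding \<phi>_def by (rule Sigma_fm_Pi_fm.intros(4)) (use \<theta>(1) \<gamma> single in blast)
  moreover have "free_vars \<phi> \<subseteq> I \<union> J"
    using \<theta>(2) by (auto simp: \<phi>_def single free_vars_foldr_All vs)
  moreover have "sat (set_order X) \<phi> s"
    unfolding \<phi>_sat sat_foldr_All Field_set_order vs
  proof (intro allI impI)
    fix u assume u: "\<forall>i\<in>e ` F. u i \<in> X" "\<forall>i. i \<notin> e ` F \<longrightarrow> u i = s i"
    have "u i \<in> X" if "i \<in> I \<union> J" for i
      using u(2) that fresh less.prems(5) by (metis imageE imageI subsetD)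
    then have "u ` (I \<union> J \<union> e ` F) \<subseteq> X"
      using u(1) by auto
    note \<chi> = \<chi>_sat[OF this]
    show "sat (set_order X) \<theta> u"
    proof (cases "u \<in> U")
      case True
      then show ?thesis
        unfolding \<theta>(3) using d(3) by blast
    next
      case False
      then have "sat (set_order X) \<chi> u"
        unfolding \<chi> U_def using u by simp
      then show ?thesis
        by (simp add: \<theta>(3))
    qed
  qed
  moreover have "\<not> sat (set_order Y) \<phi> t"
  proof
    assume "sat (set_order Y) \<phi> t"
    moreover have FY: "F \<subseteq> Y"
      using F(2) by (auto simp: between_def)
    then have "\<forall>i\<in>e ` F. t' i \<in> Y"
      using t'e by auto
    moreover have "\<forall>i. i \<notin> e ` F \<longrightarrow> t' i = t i"
      by (simp add: t'_def)
    ultimately have "sat (set_order Y) \<theta> t'"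
      unfolding \<phi>_sat sat_foldr_All Field_set_order vs by blast
    then have "sat (set_order Y) \<chi> t'"
      unfolding \<theta>(3) using d(4) by blast
    moreover have "t' ` (I \<union> J \<union> e ` F) \<subseteq> Y"
      using less.prems(6) FY t'e t'IJ by auto
    moreover have "\<forall>(a, b)\<in>E. t' a < t' b"
      using F(2) t'e t'IJ by (auto simp: E_def between_def)
    ultimately show False
      using \<chi>_sat by blast
  qed
  ultimately show ?case
    by blast
qed

section \<open>Linear orders as sets of reals\<close>

definition represents :: "'a rel \<Rightarrow> 'b::linorder set \<Rightarrow> bool" where
  "represents L X \<longleftrightarrow> (\<exists>f. inj_on f (Field L) \<and> f ` Field L = X \<and>
     (\<forall>x\<in>Field L. \<forall>y\<in>Field L. (x, y) \<in> L \<longleftrightarrow> f x \<le> f y))"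

lemma represents_sat_sentence:
  assumes "represents L X" "free_vars \<phi> = {}"
  shows "sat L \<phi> s \<longleftrightarrow> sat (set_order X) \<phi> t"
proof -
  obtain f where f: "inj_on f (Field L)" "f ` Field L = X"
    "\<forall>x\<in>Field L. \<forall>y\<in>Field L. (x, y) \<in> L \<longleftrightarrow> f x \<le> f y"
    using assms(1) unfolding represents_def by blast
  have "(f x, f y) \<in> set_order X \<longleftrightarrow> f x \<le> f y" if "x \<in> Field L" "y \<in> Field L" for x y
    using f(2) that by (auto simp: set_order_def)
  then show ?thesis
    by (intro sat_iso[where f = f]) (use f assms(2) in auto)
qed

text \<open>With no end points the pieces are \<open>X\<close> and \<open>Y\<close> themselves and
  the separating formula is a sentence, whose truth does not depend on the assignment.\<close>

lemma bf_of_bf_le: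
  fixes X Y :: "real set"
  assumes "M \<le>\<^bsub>\<beta>\<^esub> N" "represents M X" "represents N Y" "countable X" "countable Y"
  shows "bf \<beta> X Y"
proof (rule ccontr)
  assume "\<not> bf \<beta> X Y"
  then obtain \<phi> where \<phi>: "Pi_fm \<beta> \<phi>" "free_vars \<phi> = {}"
    "sat (set_order X) \<phi> undefined" "\<not> sat (set_order Y) \<phi> undefined"
    using formula_of_not_bf[OF assms(4,5), of "{}" "{}" undefined undefined \<beta>] by auto
  have "sat M \<phi> (\<lambda>i. [] ! i)"
    using represents_sat_sentence[OF assms(2) \<phi>(2)] \<phi>(3) by blast
  then have "sat N \<phi> (\<lambda>i. [] ! i)"
    using assms(1) \<phi>(1,2) by (simp add: bf_le_def bf_le_tuples_def)
  then show False
    using represents_sat_sentence[OF assms(3) \<phi>(2)] \<phi>(4) by blast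
qed

lemma isomorphic_of_similar:
  assumes "represents M X" "represents N Y" "similar X Y"
  shows "M \<cong>\<^sub>o N"
proof -
  obtain f where f: "inj_on f (Field M)" "f ` Field M = X"
    "\<And>x y. x \<in> Field M \<Longrightarrow> y \<in> Field M \<Longrightarrow> (x, y) \<in> M \<longleftrightarrow> f x \<le> f y"
    using assms(1) unfolding represents_def by blast
  obtain g where g: "inj_on g (Field N)" "g ` Field N = Y"
    "\<And>x y. x \<in> Field N \<Longrightarrow> y \<in> Field N \<Longrightarrow> (x, y) \<in> N \<longleftrightarrow> g x \<le> g y"
    using assms(2) unfolding represents_def by blast
  obtain h where h: "strict_mono_on X h" "h ` X = Y"
    using assms(3) by (auto simp: similar_def)
  define k where "k = inv_into (Field N) g \<circ> h \<circ> f"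
  have "bij_betw f (Field M) X"
    using f by (simp add: bij_betw_def)
  moreover have "bij_betw h X Y"
    using h strict_mono_on_imp_inj_on by (auto simp: bij_betw_def)
  moreover have "bij_betw (inv_into (Field N) g) Y (Field N)"
    using g(1,2) by (intro bij_betw_inv_into) (simp add: bij_betw_def)
  ultimately have k: "bij_betw k (Field M) (Field N)"
    unfolding k_def by (blast intro: bij_betw_trans)
  have gk: "g (k x) = h (f x)" if "x \<in> Field M" for x
    using that f(2) h(2) g(2) by (auto simp: k_def intro!: f_inv_into_f)
  have "(x, y) \<in> M \<longleftrightarrow> (k x, k y) \<in> N" if "x \<in> Field M" "y \<in> Field M" for x y
  proof -
    have "k x \<in> Field N" "k y \<in> Field N"
      using k that by (auto simp: bij_betw_def)
    then have "(k x, k y) \<in> N \<longleftrightarrow> h (f x) \<le> h (f y)"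
      using g(3) gk that by simp
    also have "\<dots> \<longleftrightarrow> f x \<le> f y"
      using strict_mono_on_less_iff[OF h(1), of "f y" "f x"] f(2) that by (auto simp flip: not_less)
    finally show ?thesis
      using f(3) that by simp
  qed
  then have "iso M N k"
    using k by (simp add: iso_iff2)
  then show ?thesis
    by (auto simp: isomorphic_def)
qed

lemma represents_isomorphic:
  assumes "K \<cong>\<^sub>o L" "represents K X"
  shows "represents L X"
proof -
  obtain h where "iso K L h"
    using assms(1) by (auto simp: isomorphic_def)
  then have h: "bij_betw h (Field K) (Field L)"
    "\<And>a b. a \<in> Field K \<Longrightarrow> b \<in> Field K \<Longrightarrow> (a, b) \<in> K \<longleftrightarrow> (h a, h b) \<in> L"
    by (auto simp: iso_iff2)
  obtain f where f: "inj_on f (Field K)" "f ` Field K = X"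
    "\<And>x y. x \<in> Field K \<Longrightarrow> y \<in> Field K \<Longrightarrow> (x, y) \<in> K \<longleftrightarrow> f x \<le> f y"
    using assms(2) unfolding represents_def by blast
  let ?k = "inv_into (Field K) h"
  have k: "bij_betw ?k (Field L) (Field K)"
    using h(1) by (rule bij_betw_inv_into)
  show ?thesis
    unfolding represents_def
  proof (intro exI[of _ "f \<circ> ?k"] conjI ballI)
    show "inj_on (f \<circ> ?k) (Field L)"
      using k f(1) by (auto simp: bij_betw_def intro: comp_inj_on)
    show "(f \<circ> ?k) ` Field L = X"
      using bij_betw_imp_surj_on[OF k] f(2) by (metis image_comp)
    fix x y assume xy: "x \<in> Field L" "y \<in> Field L"
    then have "?k x \<in> Field K" "?k y \<in> Field K" "h (?k x) = x" "h (?k y) = y"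
      using k h(1) by (auto simp: bij_betw_def f_inv_into_f inv_into_into)
    then show "(x, y) \<in> L \<longleftrightarrow> (f \<circ> ?k) x \<le> (f \<circ> ?k) y"
      using h(2)[of "?k x" "?k y"] f(3)[of "?k x" "?k y"] by simp
  qed
qed

section \<open>Sums of orders as successive blocks of a represented set\<close>

lemma Field_order_sum:
  "Field (order_sum I L) = {(i, a). i \<in> Field I \<and> a \<in> Field (L i)}"
proof
  show "Field (order_sum I L) \<subseteq> {(i, a). i \<in> Field I \<and> a \<in> Field (L i)}"
    by (auto simp: Field_def order_sum_def)
  show "{(i, a). i \<in> Field I \<and> a \<in> Field (L i)} \<subseteq> Field (order_sum I L)"
  proof clarify
    fix i a assume i: "i \<in> Field I" and a: "a \<in> Field (L i)"
    then obtain b where "(a, b) \<in> L i \<or> (b, a) \<in> L i"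
      by (auto simp: Field_def)
    then have "((i, a), (i, b)) \<in> order_sum I L \<or> ((i, b), (i, a)) \<in> order_sum I L"
      using i by (auto simp: order_sum_def intro: FieldI1 FieldI2)
    then show "(i, a) \<in> Field (order_sum I L)"
      by (auto intro: FieldI1 FieldI2)
  qed
qed

lemma represents_order_sum:
  assumes "represents (order_sum I L) X"
  obtains Z where "X = (\<Union>i\<in>Field I. Z i)" "\<And>i. i \<in> Field I \<Longrightarrow> represents (L i) (Z i)"
    "\<And>i j x y. (i, j) \<in> I \<Longrightarrow> i \<noteq> j \<Longrightarrow> x \<in> Z i \<Longrightarrow> y \<in> Z j \<Longrightarrow> x < y"
proof -
  let ?F = "{(i, a). i \<in> Field I \<and> a \<in> Field (L i)}"
  have F: "Field (order_sum I L) = ?F"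
    by (rule Field_order_sum)
  obtain f where f: "inj_on f ?F" "f ` ?F = X"
    "\<And>p q. p \<in> ?F \<Longrightarrow> q \<in> ?F \<Longrightarrow> (p, q) \<in> order_sum I L \<longleftrightarrow> f p \<le> f q"
    using assms unfolding represents_def F by blast
  define Z where "Z i = (\<lambda>a. f (i, a)) ` Field (L i)" for i
  show ?thesis
  proof (rule that[of Z])
    show "X = (\<Union>i\<in>Field I. Z i)"
      unfolding f(2)[symmetric] Z_def by (auto simp: image_iff)
    show "represents (L i) (Z i)" if "i \<in> Field I" for i
      unfolding represents_def
    proof (intro exI[of _ "\<lambda>a. f (i, a)"] conjI ballI)
      show "inj_on (\<lambda>a. f (i, a)) (Field (L i))"
        using f(1) that by (auto simp: inj_on_def)
      show "(\<lambda>a. f (i, a)) ` Field (L i) = Z i"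
        by (simp add: Z_def)
      show "(x, y) \<in> L i \<longleftrightarrow> f (i, x) \<le> f (i, y)" if "x \<in> Field (L i)" "y \<in> Field (L i)" for x y
        using f(3)[of "(i, x)" "(i, y)"] that \<open>i \<in> Field I\<close> by (simp add: order_sum_def)
    qed
    fix i j x y assume ij: "(i, j) \<in> I" "i \<noteq> j" and xy: "x \<in> Z i" "y \<in> Z j"
    obtain a b where ab: "a \<in> Field (L i)" "x = f (i, a)" "b \<in> Field (L j)" "y = f (j, b)"
      using xy by (auto simp: Z_def)
    have mem: "(i, a) \<in> ?F" "(j, b) \<in> ?F"
      using ij ab by (auto intro: FieldI1 FieldI2)
    then have "((i, a), (j, b)) \<in> order_sum I L"
      using ij ab by (auto simp: order_sum_def)
    then have "x \<le> y"
      using f(3)[OF mem] ab by simp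
    moreover have "x \<noteq> y"
      using inj_onD[OF f(1) _ mem] ij(2) ab by auto
    ultimately show "x < y"
      by simp
  qed
qed

lemma represents_order_plus:
  assumes "represents (order_plus K L) X"
  obtains A B where "X = A \<union> B" "represents K A" "represents L B" "\<And>a b. a \<in> A \<Longrightarrow> b \<in> B \<Longrightarrow> a < b"
proof -
  let ?F = "Inl ` Field K \<union> Inr ` Field L"
  have mem: "(Inl a, Inl b) \<in> order_plus K L \<longleftrightarrow> (a, b) \<in> K" "(Inr c, Inr d) \<in> order_plus K L \<longleftrightarrow> (c, d) \<in> L"
    for a b c d
    by (auto simp: order_plus_def)
  have F: "Field (order_plus K L) = ?F"
  proof
    show "Field (order_plus K L) \<subseteq> ?F"
      by (auto simp: Field_def order_plus_def)
    have "Inl a \<in> Field (order_plus K L)" if a: "a \<in> Field K" for a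
    proof -
      obtain b where "(a, b) \<in> K \<or> (b, a) \<in> K"
        using a by (auto simp: Field_def)
      then show ?thesis
        unfolding mem[symmetric] by (auto intro: FieldI1 FieldI2)
    qed
    moreover have "Inr a \<in> Field (order_plus K L)" if a: "a \<in> Field L" for a
    proof -
      obtain b where "(a, b) \<in> L \<or> (b, a) \<in> L"
        using a by (auto simp: Field_def)
      then show ?thesis
        unfolding mem[symmetric] by (auto intro: FieldI1 FieldI2)
    qed
    ultimately show "?F \<subseteq> Field (order_plus K L)"
      by auto
  qed
  obtain f where f: "inj_on f ?F" "f ` ?F = X"
    "\<And>p q. p \<in> ?F \<Longrightarrow> q \<in> ?F \<Longrightarrow> (p, q) \<in> order_plus K L \<longleftrightarrow> f p \<le> f q"
    using assms unfolding represents_def F by blast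
  show ?thesis
  proof (rule that[of "f ` Inl ` Field K" "f ` Inr ` Field L"])
    show "X = f ` Inl ` Field K \<union> f ` Inr ` Field L"
      using f(2) by (simp add: image_Un)
    show "represents K (f ` Inl ` Field K)"
      unfolding represents_def
    proof (intro exI[of _ "\<lambda>a. f (Inl a)"] conjI ballI)
      show "inj_on (\<lambda>a. f (Inl a)) (Field K)"
        using f(1) by (auto simp: inj_on_def)
      show "(x, y) \<in> K \<longleftrightarrow> f (Inl x) \<le> f (Inl y)" if "x \<in> Field K" "y \<in> Field K" for x y
        using f(3)[of "Inl x" "Inl y"] that by (simp add: mem)
    qed (simp add: image_image)
    show "represents L (f ` Inr ` Field L)"
      unfolding represents_def
    proof (intro exI[of _ "\<lambda>a. f (Inr a)"] conjI ballI)
      show "inj_on (\<lambda>a. f (Inr a)) (Field L)"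
        using f(1) by (auto simp: inj_on_def)
      show "(x, y) \<in> L \<longleftrightarrow> f (Inr x) \<le> f (Inr y)" if "x \<in> Field L" "y \<in> Field L" for x y
        using f(3)[of "Inr x" "Inr y"] that by (simp add: mem)
    qed (simp add: image_image)
    fix x y assume "x \<in> f ` Inl ` Field K" "y \<in> f ` Inr ` Field L"
    then obtain a b where ab: "a \<in> Field K" "x = f (Inl a)" "b \<in> Field L" "y = f (Inr b)"
      by auto
    then have "(Inl a, Inr b) \<in> order_plus K L"
      by (simp add: order_plus_def)
    then have "x \<le> y"
      using f(3)[of "Inl a" "Inr b"] ab by simp
    moreover have "x \<noteq> y"
      using inj_onD[OF f(1), of "Inl a" "Inr b"] ab by auto
    ultimately show "x < y"
      by simp
  qed
qed

section \<open>Hausdorff rank and simplicity in terms of condensation classes\<close>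

lemma Field_UNIV: "(\<And>x. (x, x) \<in> R) \<Longrightarrow> Field R = UNIV"
  by (auto intro: FieldI1)

lemma Field_omega: "Field omega = UNIV"
  and Field_omega_star: "Field omega_star = UNIV"
  and Field_zeta: "Field zeta = UNIV"
  by (rule Field_UNIV, simp add: omega_def omega_star_def zeta_def)+

lemma Field_fin_ord: "Field (fin_ord n) = {..<n}"
proof
  show "Field (fin_ord n) \<subseteq> {..<n}"
    by (auto simp: Field_def fin_ord_def)
  have "(x, x) \<in> fin_ord n" if "x < n" for x
    using that by (simp add: fin_ord_def)
  then show "{..<n} \<subseteq> Field (fin_ord n)"
    by (auto intro: FieldI1)
qed

text \<open>The two alternatives serve sums along \<open>omega\<close> and along
  \<open>omega_star\<close>, where the blocks descend.\<close>

lemma small_UN: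
  fixes Z :: "nat \<Rightarrow> 'a::linorder set"
  assumes "\<And>i. i \<le> n \<Longrightarrow> small \<alpha> (Z i)"
    and "(\<forall>i j x y. i < j \<and> j \<le> n \<and> x \<in> Z i \<and> y \<in> Z j \<longrightarrow> x < y) \<or>
         (\<forall>i j x y. i < j \<and> j \<le> n \<and> x \<in> Z i \<and> y \<in> Z j \<longrightarrow> y < x)"
  shows "small \<alpha> (\<Union>i\<le>n. Z i)"
  using assms
proof (induction n)
  case 0
  then show ?case
    by simp
next
  case (Suc n)
  have IH: "small \<alpha> (\<Union>i\<le>n. Z i)"
  proof (rule Suc.IH)
    show "small \<alpha> (Z i)" if "i \<le> n" for i
      using that by (intro Suc.prems(1)) simp
  qed (use Suc.prems(2) le_SucI in meson)
  have step: "small \<alpha> (Z (Suc n))"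
    by (rule Suc.prems) simp
  have eq: "(\<Union>i\<le>Suc n. Z i) = (\<Union>i\<le>n. Z i) \<union> Z (Suc n)"
    by (auto simp: atMost_Suc)
  from Suc.prems(2) show ?case
  proof
    assume *: "\<forall>i j x y. i < j \<and> j \<le> Suc n \<and> x \<in> Z i \<and> y \<in> Z j \<longrightarrow> x < y"
    have "x < y" if "x \<in> Z i" "i \<le> n" "y \<in> Z (Suc n)" for i x y
      using *[rule_format, of i "Suc n" x y] that by simp
    then show ?thesis
      unfolding eq by (intro small_Un[OF IH step]) auto
  next
    assume *: "\<forall>i j x y. i < j \<and> j \<le> Suc n \<and> x \<in> Z i \<and> y \<in> Z j \<longrightarrow> y < x"
    have "y < x" if "x \<in> Z i" "i \<le> n" "y \<in> Z (Suc n)" for i x y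
      using *[rule_format, of i "Suc n" x y] that by simp
    then show ?thesis
      unfolding eq Un_commute[of _ "Z (Suc n)"] by (intro small_Un[OF step IH]) auto
  qed
qed

text \<open>In a sum along \<open>zeta\<close>, two points lie only finitely many blocks apart, so
  the interval between them is covered by finitely many small blocks and there is a single class.
  Finite sums add up class bounds.\<close>

lemma HR_imp_rank_le:
  fixes X :: "real set"
  assumes "HR \<alpha> L" "represents L X"
  shows "rank_le \<alpha> X"
  using assms
proof (induction arbitrary: X rule: HR.induct)
  case (finite_order L)
  then have "finite X"
    by (auto simp: represents_def)
  then show ?case
    by (rule rank_le_finite)
next
  case (zeta_sum \<alpha> L K)
  obtain Z where Z: "X = (\<Union>i. Z i)" "\<And>i. represents (L i) (Z i)"
    "\<And>i j x y. i < j \<Longrightarrow> x \<in> Z i \<Longrightarrow> y \<in> Z j \<Longrightarrow> x < y"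
    using represents_order_sum[OF represents_isomorphic[OF zeta_sum.hyps(2) zeta_sum.prems]]
    unfolding Field_zeta by (auto simp: zeta_def order_le_less)
  have small: "small \<alpha> (Z i)" for i
    using zeta_sum.IH[of i] Z(2)[of i] by (auto simp: small_def)
  have gap: "\<not> gap \<alpha> X x y" if x: "x \<in> X" and y: "y \<in> X" for x y
  proof
    assume "gap \<alpha> X x y"
    then have xy: "x < y" "\<not> small \<alpha> (X \<inter> {x<..<y})"
      by (auto simp: gap_def)
    obtain i j where ij: "x \<in> Z i" "y \<in> Z j"
      using x y Z(1) by auto
    define n where "n = nat (j - i)"
    have "X \<inter> {x<..<y} \<subseteq> (\<Union>k\<le>n. Z (i + int k))"
    proof
      fix z assume z: "z \<in> X \<inter> {x<..<y}"
      then obtain k where k: "z \<in> Z k"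
        using Z(1) by auto
      have "i \<le> k" "k \<le> j"
        using Z(3)[of k i z x] Z(3)[of j k y z] k ij z by force+
      then show "z \<in> (\<Union>k\<le>n. Z (i + int k))"
        using k by (intro UN_I[of "nat (k - i)"]) (auto simp: n_def)
    qed
    moreover have "x < y" if "k < l" "x \<in> Z (i + int k)" "y \<in> Z (i + int l)" for k l x y
      using Z(3)[OF _ that(2,3)] that(1) by simp
    then have "small \<alpha> (\<Union>k\<le>n. Z (i + int k))"
      by (intro small_UN[OF small disjI1]) blast
    ultimately show False
      using xy(2) small_subset by blast
  qed
  have "length xs \<le> Suc 0" if "set xs \<subseteq> X" "successively (gap \<alpha> X) xs" for xs
  proof (cases xs rule: remdups_adj.cases)
    case (3 x y zs)
    then show ?thesis
      using that gap[of x y] by simp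
  qed auto
  then show ?case
    unfolding rank_le_iff classes_le_def by blast
next
  case (finite_sum \<alpha> n L K)
  obtain Z where Z: "X = (\<Union>i\<in>{..<n}. Z i)" "\<And>i. i < n \<Longrightarrow> represents (L i) (Z i)"
    "\<And>i j x y. i < j \<and> j < n \<Longrightarrow> x \<in> Z i \<Longrightarrow> y \<in> Z j \<Longrightarrow> x < y"
    using represents_order_sum[OF represents_isomorphic[OF finite_sum.hyps(3) finite_sum.prems]]
    unfolding Field_fin_ord by (auto simp: fin_ord_def order_le_less)
  have "rank_le \<alpha> (\<Union>i\<in>{..<m}. Z i)" if "m \<le> n" for m
    using that
  proof (induction m)
    case 0
    then show ?case
      by (simp add: rank_le_finite)
  next
    case (Suc m)
    have "rank_le \<alpha> (Z m)"
      using finite_sum.IH[of m] Z(2)[of m] Suc.prems by auto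
    then have "rank_le \<alpha> ((\<Union>i\<in>{..<m}. Z i) \<union> Z m)"
      using Suc Z(3)[of _ m] by (intro rank_le_Un) auto
    moreover have "(\<Union>i\<in>{..<Suc m}. Z i) = (\<Union>i\<in>{..<m}. Z i) \<union> Z m"
      by (auto simp: lessThan_Suc)
    ultimately show ?case
      by simp
  qed
  then show ?case
    using Z(1) by simp
qed

text \<open>A point in a block of the left sum has only finitely many blocks meeting its initial
  segment; on the right the same holds for final segments. Finite unions of the small blocks are
  small.\<close>

lemma simple_imp_short:
  fixes X :: "real set"
  assumes "simple_order L" "has_rank L \<alpha>" "represents L X"
  shows "short \<alpha> X"
proof -
  obtain \<alpha>' A B \<rho> \<sigma> where L: "has_rank L \<alpha>'"
    "\<forall>i :: nat. has_rank (A i :: 'a rel) (\<rho> i) \<and> \<rho> i < \<alpha>'"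
    "\<forall>j :: nat. has_rank (B j :: 'a rel) (\<sigma> j) \<and> \<sigma> j < \<alpha>'"
    "L \<cong>\<^sub>o order_plus (order_sum omega A) (order_sum omega_star B)"
    using assms(1) unfolding simple_order_def by blast
  have "\<alpha>' = \<alpha>"
    using L(1) assms(2) unfolding has_rank_def by (metis linorder_neqE)
  obtain P Q where PQ: "X = P \<union> Q" "represents (order_sum omega A) P" "represents (order_sum omega_star B) Q"
    "\<And>a b. a \<in> P \<Longrightarrow> b \<in> Q \<Longrightarrow> a < b"
    using represents_order_plus[OF represents_isomorphic[OF L(4) assms(3)]] by metis
  obtain Y where Y: "P = (\<Union>i. Y i)" "\<And>i. represents (A i) (Y i)"
    "\<And>i j x y. i < j \<Longrightarrow> x \<in> Y i \<Longrightarrow> y \<in> Y j \<Longrightarrow> x < y"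
    using represents_order_sum[OF PQ(2)] unfolding Field_omega by (auto simp: omega_def order_le_less)
  obtain Z where Z0: "Q = (\<Union>i. Z i)" "\<And>i. represents (B i) (Z i)"
    "\<And>i j x y. (i, j) \<in> omega_star \<Longrightarrow> i \<noteq> j \<Longrightarrow> x \<in> Z i \<Longrightarrow> y \<in> Z j \<Longrightarrow> x < y"
    using represents_order_sum[OF PQ(3)] unfolding Field_omega_star by auto
  have "y < x" if "i < j" "x \<in> Z i" "y \<in> Z j" for i j x y
    using Z0(3)[of j i y x] that by (simp add: omega_star_def)
  note Z = Z0(1,2) this
  have smallY: "small \<alpha> (Y i)" and smallZ: "small \<alpha> (Z i)" for i
    using L(2,3) Y(2)[of i] Z(2)[of i] HR_imp_rank_le unfolding has_rank_def small_def \<open>\<alpha>' = \<alpha>\<close> by blast+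
  show ?thesis
    unfolding short_def
  proof
    fix x assume "x \<in> X"
    then consider i where "x \<in> Y i" | j where "x \<in> Z j"
      using PQ(1) Y(1) Z(1) by auto
    then show "small \<alpha> (X \<inter> {..<x}) \<or> small \<alpha> (X \<inter> {x<..})"
    proof cases
      case 1
      have "X \<inter> {..<x} \<subseteq> (\<Union>k\<le>i. Y k)"
      proof
        fix z assume z: "z \<in> X \<inter> {..<x}"
        then have "z \<notin> Q"
          using PQ(4)[of x z] 1 Y(1) by auto
        then obtain k where k: "z \<in> Y k"
          using z PQ(1) Y(1) by auto
        then have "\<not> i < k"
          using Y(3)[of i k x z] 1 z by auto
        then show "z \<in> (\<Union>k\<le>i. Y k)"
          using k by auto
      qed
      moreover have "small \<alpha> (\<Union>k\<le>i. Y k)"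
        by (rule small_UN[OF smallY disjI1]) (use Y(3) in blast)
      ultimately show ?thesis
        using small_subset by blast
    next
      case 2
      have "X \<inter> {x<..} \<subseteq> (\<Union>k\<le>j. Z k)"
      proof
        fix z assume z: "z \<in> X \<inter> {x<..}"
        then have "z \<notin> P"
          using PQ(4)[of z x] 2 Z(1) by auto
        then obtain k where k: "z \<in> Z k"
          using z PQ(1) Z(1) by auto
        then have "\<not> j < k"
          using Z(3)[of j k x z] 2 z by auto
        then show "z \<in> (\<Union>k\<le>j. Z k)"
          using k by auto
      qed
      moreover have "small \<alpha> (\<Union>k\<le>j. Z k)"
        by (rule small_UN[OF smallZ disjI2]) (use Z(3) in blast)
      ultimately show ?thesis
        using small_subset by blast
    qed
  qed
qed

text \<open>Each element receives the weight \<open>(1/2) ^ k\<close>, where \<open>k\<close> is its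
  index in an enumeration, and \<open>x\<close> is sent to the total weight of the elements up to
  \<open>x\<close>.\<close>

lemma countable_represents:
  assumes "Linear_order L" "countable (Field L)"
  obtains X :: "real set" where "represents L X" "countable X"
proof -
  have refl: "(x, x) \<in> L" if "x \<in> Field L" for x
    using assms(1) that by (auto simp: order_on_defs refl_on_def)
  have trans: "trans L" and antisym: "antisym L" and total: "total_on (Field L) L"
    using assms(1) by (auto simp: order_on_defs)
  define n where "n = to_nat_on (Field L)"
  have n: "inj_on n (Field L)"
    unfolding n_def by (rule inj_on_to_nat_on[OF assms(2)])
  define D where "D x = {y. (y, x) \<in> L}" for x
  define c where "c x k = (if k \<in> n ` D x then (1/2) ^ k else 0 :: real)" for x and k :: nat
  have summable: "summable (c x)" for x
    by (rule summable_comparison_test'[OF summable_geometric[of "1/2 :: real"], of 0]) (auto simp: c_def)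
  define f where "f x = suminf (c x)" for x
  have less: "f x < f y" if "(x, y) \<in> L" "x \<noteq> y" for x y
  proof -
    have mem: "x \<in> Field L" "y \<in> Field L"
      using that(1) by (auto intro: FieldI1 FieldI2)
    have sub: "D x \<subseteq> D y"
      using trans that(1) by (auto simp: D_def dest: transD)
    \<comment> \<open>The weight of \<open>y\<close> counts towards \<open>f y\<close> but not
      towards \<open>f x\<close>, which makes the inequality strict.\<close>
    have "n y \<notin> n ` D x"
    proof
      assume "n y \<in> n ` D x"
      then obtain z where z: "(z, x) \<in> L" "n z = n y"
        by (auto simp: D_def)
      then have "z = y"
        using inj_onD[OF n z(2)] mem by (auto intro: FieldI1)
      then show False
        using antisymD[OF antisym that(1)] z(1) that(2) by blast
    qed
    then have "0 < c y (n y) - c x (n y)"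
      using refl[OF mem(2)] by (auto simp: c_def D_def)
    moreover have "0 \<le> c y k - c x k" for k
      using sub by (auto simp: c_def)
    ultimately have "0 < (\<Sum>k. c y k - c x k)"
      by (intro suminf_pos2[of _ "n y"] summable_diff summable) auto
    then show ?thesis
      using suminf_diff[OF summable summable, of y x] by (simp add: f_def)
  qed
  have "represents L (f ` Field L)"
    unfolding represents_def
  proof (intro exI[of _ f] conjI ballI)
    show "inj_on f (Field L)"
    proof (rule inj_onI)
      fix x y assume "x \<in> Field L" "y \<in> Field L" "f x = f y"
      then show "x = y"
        using less[of x y] less[of y x] total unfolding total_on_def by force
    qed
    show "(x, y) \<in> L \<longleftrightarrow> f x \<le> f y" if "x \<in> Field L" "y \<in> Field L" for x y
    proof (cases "x = y")
      case False
      then show ?thesis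
        using less[of x y] less[of y x] total that unfolding total_on_def by force
    qed (use refl that in simp)
  qed simp
  then show ?thesis
    using that assms(2) by blast
qed

text \<open>Both orders are carried to countable sets of reals. Simplicity becomes shortness, the
  relation between formulas becomes the game at level 2\<alpha>+1, and the isomorphism of the sets
  is pulled back.\<close>

theorem theorem2p8:
  fixes M :: "'a rel" and \<alpha> :: cord
  assumes "Linear_order M" and "countable (Field M)"
    and "simple_order M" and "has_rank M \<alpha>"
    and "\<And>\<beta> (M' :: nat rel) (N' :: nat rel).
      \<lbrakk>\<beta> < \<alpha>;
       Linear_order M'; countable (Field M'); scattered M'; has_rank M' \<beta>;
       Linear_order N'; countable (Field N'); scattered N'; has_rank N' \<beta>;
       M' \<le>\<^bsub>osucc (osucc (odouble \<beta>))\<^esub> N'\<rbrakk> \<Longrightarrow> M' \<cong>\<^sub>o N'"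
  shows "\<forall>N :: 'b rel. Linear_order N \<longrightarrow> countable (Field N) \<longrightarrow>
    M \<le>\<^bsub>osucc (odouble \<alpha>)\<^esub> N \<longrightarrow> M \<cong>\<^sub>o N"
proof (intro allI impI)
  fix N :: "'b rel"
  assume N: "Linear_order N" "countable (Field N)" and le: "M \<le>\<^bsub>osucc (odouble \<alpha>)\<^esub> N"
  obtain X :: "real set" where X: "represents M X" "countable X"
    using countable_represents[OF assms(1,2)] .
  obtain Y :: "real set" where Y: "represents N Y" "countable Y"
    using countable_represents[OF N] .
  have "similar X Y"
    using all_short_rigid[of \<alpha>] simple_imp_short[OF assms(3,4) X(1)] bf_of_bf_le[OF le X(1) Y(1) X(2) Y(2)]
    unfolding short_rigid_def by blast
  then show "M \<cong>\<^sub>o N"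
    by (rule isomorphic_of_similar[OF X(1) Y(1)])
qed

end
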